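(* If $1<p<\infty$ and $0<s\le n/p$, a function $g$ is a pointwise multiplier of $HM^{p,s}$ if and only if $g\in H^\infty$.
   Context: $n>1$; $\mathbb{B}$ is the unit ball of $\mathbb{C}^n$, $\mathbb{S}$ its boundary, $d\sigma$ Lebesgue measure on $\mathbb{S}$; $\eta\bar\zeta=\sum_j\eta_j\bar\zeta_j$; $I_{\zeta,\varepsilon}=\{\eta\in\mathbb{S}:|1-\eta\bar\zeta|<\varepsilon\}$. $M^{p,s}$ is the space of $f\in L^p(\mathbb{S})$ with $\|f\|_{M^{p,s}}=\sup_{\zeta\in\mathbb{S},\,\varepsilon>0}\left(\varepsilon^{sp-n}\int_{I_{\zeta,\varepsilon}}|f(\eta)|^p\,d\sigma(\eta)\right)^{1/p}<\infty$ (so $M^{p,n/p}=L^p(\mathbb{S})$), and $HM^{p,s}=M^{p,s}\cap H^p$, where $H^p$ is the Hardy space of $\mathbb{B}$ (functions identified with their boundary values). $H^\infty$ is the space of bounded holomorphic functions on $\mathbb{B}$. A function $g$ is a pointwise multiplier of $X$ if $f\mapsto gf$ maps $X$ (boundedly) to itself. *)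

theory Defs
  imports "HOL-Analysis.Analysis"
begin

text \<open>
  Surface measure in polar coordinates: the measure of \<open>E\<close> is \<open>d\<close> times the volume of the cone
  \<open>{r x | x \<in> E, 0 < r < 1}\<close>, where \<open>d\<close> is the real dimension. It lives on the Borel subsets of
  the sphere, so that values of functions off the sphere play no role.
\<close>

definition surface_measure :: "'a::euclidean_space measure" where
  "surface_measure =
     scale_measure (of_nat DIM('a))
       (distr (restrict_space lborel (ball 0 1 - {0})) (restrict_space borel (sphere 0 1))
         (\<lambda>x. x /\<^sub>R norm x))"

definition hdot :: "complex ^ 'n \<Rightarrow> complex ^ 'n \<Rightarrow> complex" where
  "hdot \<eta> \<zeta> = (\<Sum>j\<in>UNIV. \<eta> $ j * cnj (\<zeta> $ j))"

definition nonisotropic_ball :: "complex ^ 'n \<Rightarrow> real \<Rightarrow> (complex ^ 'n) set" where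
  "nonisotropic_ball \<zeta> \<epsilon> = {\<eta> \<in> sphere 0 1. cmod (1 - hdot \<eta> \<zeta>) < \<epsilon>}"

definition Lp_sphere :: "real \<Rightarrow> (complex ^ 'n \<Rightarrow> complex) set" where
  "Lp_sphere p = {f \<in> borel_measurable surface_measure.
                    integrable surface_measure (\<lambda>\<eta>. cmod (f \<eta>) powr p)}"

definition morrey_mean ::
    "real \<Rightarrow> real \<Rightarrow> (complex ^ 'n \<Rightarrow> complex) \<Rightarrow> complex ^ 'n \<Rightarrow> real \<Rightarrow> real" where
  "morrey_mean p s f \<zeta> \<epsilon> =
     (\<epsilon> powr (s * p - real CARD('n)) *
       (LINT \<eta>:nonisotropic_ball \<zeta> \<epsilon>|surface_measure. cmod (f \<eta>) powr p)) powr (1 / p)"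

definition morrey :: "real \<Rightarrow> real \<Rightarrow> (complex ^ 'n \<Rightarrow> complex) set" where
  "morrey p s = {f \<in> Lp_sphere p.
      bdd_above ((\<lambda>(\<zeta>, \<epsilon>). morrey_mean p s f \<zeta> \<epsilon>) ` (sphere 0 1 \<times> {0<..}))}"

text \<open>Meaningful on \<^const>\<open>morrey\<close>; a supremum of an unbounded set of reals is unspecified.\<close>

definition morrey_norm :: "real \<Rightarrow> real \<Rightarrow> (complex ^ 'n \<Rightarrow> complex) \<Rightarrow> real" where
  "morrey_norm p s f = (SUP (\<zeta>, \<epsilon>) \<in> sphere 0 1 \<times> {0<..}. morrey_mean p s f \<zeta> \<epsilon>)"

text \<open>
  Holomorphy in several variables, as existence of a complex-linear Frechet derivative; meant for
  open \<open>U\<close>.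
\<close>

definition holomorphic_vec_on :: "(complex ^ 'n \<Rightarrow> complex) \<Rightarrow> (complex ^ 'n) set \<Rightarrow> bool" where
  "holomorphic_vec_on f U \<longleftrightarrow>
     (\<forall>z\<in>U. \<exists>D. (f has_derivative D) (at z) \<and> (\<forall>c v. D (c *s v) = c * D v))"

text \<open>
  Elements of the following spaces are functions on the unit ball; they are represented by total
  functions, whose values off the open ball are irrelevant.
\<close>

definition hardy :: "real \<Rightarrow> (complex ^ 'n \<Rightarrow> complex) set" where
  "hardy p = {f. holomorphic_vec_on f (ball 0 1) \<and>
      bdd_above ((\<lambda>r. LINT \<zeta>|surface_measure. cmod (f (r *\<^sub>R \<zeta>)) powr p) ` {0<..<1})}"

definition hardy_infinity :: "(complex ^ 'n \<Rightarrow> complex) set" where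
  "hardy_infinity = {f. holomorphic_vec_on f (ball 0 1) \<and> bounded (f ` ball 0 1)}"

definition boundary_value :: "(complex ^ 'n \<Rightarrow> complex) \<Rightarrow> complex ^ 'n \<Rightarrow> complex" where
  "boundary_value f \<zeta> = Lim (at_left 1) (\<lambda>r. f (r *\<^sub>R \<zeta>))"

text \<open>
  The intersection of the Morrey space with the Hardy space under the identification of \<open>f\<close> with
  its boundary values. The second condition says that \<open>f\<close> has boundary values at all (\<open>Lim\<close> is
  unspecified where the limit does not exist); by Fatou's theorem it excludes no \<open>f \<in> hardy p\<close>.
\<close>

definition hardy_morrey :: "real \<Rightarrow> real \<Rightarrow> (complex ^ 'n \<Rightarrow> complex) set" where
  "hardy_morrey p s = {f \<in> hardy p.
      (AE \<zeta> in surface_measure. ((\<lambda>r. f (r *\<^sub>R \<zeta>)) \<longlongrightarrow> boundary_value f \<zeta>) (at_left 1)) \<and>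
      boundary_value f \<in> morrey p s}"

definition hardy_morrey_norm :: "real \<Rightarrow> real \<Rightarrow> (complex ^ 'n \<Rightarrow> complex) \<Rightarrow> real" where
  "hardy_morrey_norm p s f = morrey_norm p s (boundary_value f)"

definition pointwise_multiplier ::
    "('a \<Rightarrow> complex) set \<Rightarrow> (('a \<Rightarrow> complex) \<Rightarrow> real) \<Rightarrow> ('a \<Rightarrow> complex) \<Rightarrow> bool" where
  "pointwise_multiplier X N g \<longleftrightarrow>
     (\<forall>f\<in>X. (\<lambda>z. g z * f z) \<in> X) \<and> (\<exists>C. \<forall>f\<in>X. N (\<lambda>z. g z * f z) \<le> C * N f)"

end

theory Submission
  imports Defs "HOL-Complex_Analysis.Complex_Analysis"
begin

text \<open>
  If \<open>g\<close> is bounded and holomorphic then \<open>g f\<close> is dominated by \<open>f\<close>; what needs proof is that \<open>g f\<close> has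
  radial limits almost everywhere. On each complex line through the origin this is Fatou's theorem
  for the disc, which follows from the Hardy-Littlewood maximal inequality and the convergence of
  Taylor polynomials in the mean square; rotation invariance carries it over to the sphere.

  Conversely, let \<open>g\<close> be a multiplier with bound \<open>C\<close>. The constant \<open>1\<close> lies in the space because the
  nonisotropic balls have measure \<open>O (\<epsilon> ^ n)\<close>, so all powers \<open>g ^ k\<close> lie in it, with norm at most
  \<open>C ^ k\<close> times that of \<open>1\<close>. Point evaluations are bounded, hence \<open>\<bar>g z\<bar> ^ k \<le> Q z * C ^ k\<close> for all \<open>k\<close>,
  which forces \<open>\<bar>g z\<bar> \<le> C\<close>.
\<close>

subsection \<open>Isometries and Lebesgue measure\<close>

text \<open>The norm sees only the boundary function, whereas the Hardy condition bounds the dilates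
  of each function by a constant that the norm is not known to control. A point value is therefore
  first estimated by means over spheres of radius r < 1; the passage r -> 1 rests on p > 1, which
  makes the dilates uniformly integrable. The constants may depend on the point in any way, since
  they are compared with a geometric sequence, so crude estimates suffice. In the other direction no
  boundary function of g is available at the start. All estimates in the disc are therefore made for
  the dilates h(R z), which are holomorphic across the unit circle, with constants uniform in R. The
  passage to several variables uses the invariance of Lebesgue measure under isometries.
  Multiplication by a unimodular scalar is one of them, and averaging over these scalars reduces
  statements on the ball to circles in complex lines; another one brings a nonisotropic ball into
  coordinate position.\<close>

lemma nn_integral_lborel_translate:
  fixes f :: "'a::euclidean_space \<Rightarrow> ennreal"
  assumes [measurable]: "f \<in> borel_measurable borel"
  shows "(\<integral>\<^sup>+x. f (c + x) \<partial>lborel) = (\<integral>\<^sup>+x. f x \<partial>lborel)"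
proof -
  have "(\<integral>\<^sup>+x. f x \<partial>lborel) = (\<integral>\<^sup>+x. f x \<partial>distr lborel borel ((+) c))"
    by (simp add: lborel_distr_plus)
  also have "\<dots> = (\<integral>\<^sup>+x. f (c + x) \<partial>lborel)"
    by (subst nn_integral_distr) auto
  finally show ?thesis ..
qed

lemma isometry_surj:
  fixes T :: "'a::euclidean_space \<Rightarrow> 'a"
  assumes "linear T" and "\<And>x. norm (T x) = norm x"
  shows "surj T"
proof (rule linear_inj_imp_surj[OF assms(1)])
  show "inj T"
  proof (rule injI)
    fix x y assume "T x = T y"
    then have "T (x - y) = 0" by (simp add: linear_diff assms(1))
    then show "x = y" using assms(2)[of "x - y"] by simp
  qed
qed

text \<open>The image measure is translation invariant, so exchanging the order of integration in
  \<open>\<integral>\<integral> indicator A (T x) * indicator B (y - T x)\<close> shows that it is proportional to Lebesgue measure;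
  the two agree on the unit ball \<open>B\<close>.\<close>

lemma lborel_distr_isometry:
  fixes T :: "'a::euclidean_space \<Rightarrow> 'a"
  assumes lin: "linear T" and iso: "\<And>x. norm (T x) = norm x"
  shows "distr lborel borel T = lborel"
proof (rule measure_eqI)
  fix A :: "'a set" assume "A \<in> sets (distr lborel borel T)"
  then have A[measurable]: "A \<in> sets borel" by simp
  have T[measurable]: "T \<in> borel_measurable borel"
    using lin by (intro borel_measurable_continuous_onI linear_continuous_on linear_conv_bounded_linear[THEN iffD1])
  define B where "B = ball (0::'a) 1"
  have B[measurable]: "B \<in> sets borel" by (simp add: B_def)
  have eqB: "indicator B (- T x) = (indicator B x :: ennreal)" for x
    by (simp add: B_def indicator_def iso)
  have "emeasure (distr lborel borel T) A * emeasure lborel B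
     = (\<integral>\<^sup>+x. indicator A (T x) * emeasure lborel B \<partial>lborel)"
    by (subst nn_integral_multc)
      (simp_all add: nn_integral_indicator[symmetric] nn_integral_distr del: nn_integral_indicator)
  also have "\<dots> = (\<integral>\<^sup>+x. \<integral>\<^sup>+y. indicator A (T x) * indicator B (- T x + y) \<partial>lborel \<partial>lborel)"
    by (subst nn_integral_cmult, simp, subst nn_integral_lborel_translate) auto
  also have "\<dots> = (\<integral>\<^sup>+y. \<integral>\<^sup>+x. indicator A (T x) * indicator B (- T x + y) \<partial>lborel \<partial>lborel)"
    by (rule lborel_pair.Fubini') measurable
  also have "\<dots> = (\<integral>\<^sup>+y. \<integral>\<^sup>+x. indicator A (T x + y) * indicator B x \<partial>lborel \<partial>lborel)"
  proof (rule nn_integral_cong)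
    fix y :: 'a
    \<comment> \<open>By surjectivity the shift by \<open>y\<close> becomes a translation of
      \<open>x\<close> by \<open>z\<close>. The ball is chosen as test set because it is symmetric
      and \<open>T\<close> preserves norms, so that \<open>- T x\<close> may be replaced by
      \<open>x\<close> in the second factor.\<close>
    obtain z where z: "y = T z" using isometry_surj[OF lin iso] by auto
    have "(\<integral>\<^sup>+x. indicator A (T x) * indicator B (- T x + y) \<partial>lborel)
      = (\<integral>\<^sup>+x. indicator A (T (z + x)) * indicator B (- T (z + x) + y) \<partial>lborel)"
      by (rule nn_integral_lborel_translate[symmetric]) measurable
    also have "\<dots> = (\<integral>\<^sup>+x. indicator A (T x + y) * indicator B x \<partial>lborel)"
      by (rule nn_integral_cong) (simp add: linear_add[OF lin] z eqB add.commute)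
    finally show "(\<integral>\<^sup>+x. indicator A (T x) * indicator B (- T x + y) \<partial>lborel) = \<dots>" .
  qed
  also have "\<dots> = (\<integral>\<^sup>+x. \<integral>\<^sup>+y. indicator A (T x + y) * indicator B x \<partial>lborel \<partial>lborel)"
    by (rule lborel_pair.Fubini'[symmetric]) measurable
  also have "\<dots> = (\<integral>\<^sup>+x. emeasure lborel A * indicator B x \<partial>lborel)"
    by (subst nn_integral_multc, simp, subst nn_integral_lborel_translate) auto
  also have "\<dots> = emeasure lborel A * emeasure lborel B"
    by (subst nn_integral_cmult) auto
  finally have "emeasure lborel B * emeasure (distr lborel borel T) A = emeasure lborel B * emeasure lborel A"
    by (simp add: mult.commute)
  moreover have "emeasure lborel B \<noteq> 0"
    using content_ball_pos[of 1 "0::'a"] by (auto simp: B_def measure_def)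
  moreover have "emeasure lborel B \<noteq> \<infinity>"
    using emeasure_lborel_ball_finite[of "0::'a" 1] by (auto simp: B_def)
  ultimately show "emeasure (distr lborel borel T) A = emeasure lborel A"
    using ennreal_mult_cancel_left by auto
qed simp

lemma nn_integral_lborel_isometry:
  fixes T :: "'a::euclidean_space \<Rightarrow> 'a" and f :: "'a \<Rightarrow> ennreal"
  assumes lin: "linear T" and iso: "\<And>x. norm (T x) = norm x"
    and [measurable]: "f \<in> borel_measurable borel"
  shows "(\<integral>\<^sup>+x. f (T x) \<partial>lborel) = (\<integral>\<^sup>+x. f x \<partial>lborel)"
proof -
  have [measurable]: "T \<in> borel_measurable borel"
    using lin by (intro borel_measurable_continuous_onI linear_continuous_on linear_conv_bounded_linear[THEN iffD1])
  have "(\<integral>\<^sup>+x. f x \<partial>lborel) = (\<integral>\<^sup>+x. f x \<partial>distr lborel borel T)"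
    by (simp add: lborel_distr_isometry[OF lin iso])
  also have "\<dots> = (\<integral>\<^sup>+x. f (T x) \<partial>lborel)"
    by (subst nn_integral_distr) auto
  finally show ?thesis ..
qed

text \<open>The Householder reflection in the hyperplane orthogonal to \<open>v\<close>. It is the
  identity for \<open>v = 0\<close>, which covers the case that a point is to be moved to
  itself.\<close>

definition reflect :: "'a::real_inner \<Rightarrow> 'a \<Rightarrow> 'a" where
  "reflect v x = x - (2 * (x \<bullet> v) / (v \<bullet> v)) *\<^sub>R v"

lemma linear_reflect: "linear (reflect v)"
  by (rule linearI) (auto simp: reflect_def algebra_simps inner_simps add_divide_distrib)

lemma norm_reflect: "norm (reflect v x) = norm x"
proof -
  have "reflect v x \<bullet> reflect v x = x \<bullet> x"
    by (cases "v = 0") (auto simp: reflect_def inner_simps field_simps power2_eq_square inner_commute)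
  then show ?thesis by (simp add: norm_eq_sqrt_inner)
qed

lemma reflect_diff:
  assumes "norm a = norm b"
  shows "reflect (a - b) a = b"
proof (cases "a = b")
  case True then show ?thesis by (simp add: reflect_def)
next
  case False
  have eq: "a \<bullet> a = b \<bullet> b" using assms by (simp add: norm_eq)
  have "2 * (a \<bullet> (a - b)) = (a - b) \<bullet> (a - b)"
    using eq by (simp add: inner_simps inner_commute)
  then show ?thesis using False by (simp add: reflect_def)
qed

lemma reflect_orthogonal: "x \<bullet> v = 0 \<Longrightarrow> reflect v x = x"
  by (simp add: reflect_def)

text \<open>Two reflections suffice: once the first has taken \<open>a\<close> to \<open>a'\<close>,
  the vector \<open>S b - b'\<close> is orthogonal to \<open>a'\<close>, so the second reflection
  leaves \<open>a'\<close> fixed.\<close>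

lemma isometry_orthonormal_pair:
  fixes a b a' b' :: "'a::real_inner"
  assumes "norm a = 1" "norm b = 1" "a \<bullet> b = 0" "norm a' = 1" "norm b' = 1" "a' \<bullet> b' = 0"
  obtains T where "linear T" "\<And>x. norm (T x) = norm x" "T a = a'" "T b = b'"
proof -
  define S where "S = reflect (a - a')"
  define T where "T = reflect (S b - b') \<circ> S"
  have S: "linear S" "\<And>x. norm (S x) = norm x" "S a = a'"
    unfolding S_def using assms by (auto simp: linear_reflect norm_reflect reflect_diff)
  have inner: "S x \<bullet> S y = x \<bullet> y" for x y
    using S(2)[of "x + y"] S(2)[of x] S(2)[of y]
    by (simp add: linear_add[OF S(1)] norm_eq inner_simps inner_commute)
  have "a' \<bullet> (S b - b') = 0"
    using inner[of a b] assms S(3) by (simp add: inner_simps)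
  then have "T a = a'" by (simp add: T_def S reflect_orthogonal)
  moreover have "T b = b'" by (simp add: T_def reflect_diff S assms)
  moreover have "linear T" unfolding T_def by (intro linear_compose S linear_reflect)
  ultimately show ?thesis using that[of T] by (simp add: T_def norm_reflect S)
qed

subsection \<open>The unit circle\<close>

text \<open>The period is scaled to 1, so that Lebesgue measure on \<open>{0..1}\<close> is
  normalised arc length and no factors \<open>2 * pi\<close> appear in means over the
  circle.\<close>

definition circ :: "real \<Rightarrow> complex" where
  "circ t = cis (2 * pi * t)"

lemma norm_circ [simp]: "norm (circ t) = 1"
  by (simp add: circ_def)

lemma circ_nonzero [simp]: "circ t \<noteq> 0"
  using norm_circ[of t] by (metis norm_zero zero_neq_one)

lemma circ_add: "circ (s + t) = circ s * circ t"
  by (simp add: circ_def cis_mult algebra_simps)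

lemma circ_0 [simp]: "circ 0 = 1" by (simp add: circ_def)

lemma circ_1 [simp]: "circ 1 = 1" by (simp add: circ_def)

lemma circ_half [simp]: "circ (1 / 2) = -1" by (simp add: circ_def)

lemma circ_conv_exp: "circ t = exp (2 * of_real pi * \<i> * of_real t)"
  by (simp add: circ_def cis_conv_exp mult_ac)

lemma continuous_on_circ [continuous_intros]:
  "continuous_on A f \<Longrightarrow> continuous_on A (\<lambda>x. circ (f x))"
  unfolding circ_def by (intro continuous_intros)

lemma has_vector_derivative_circ:
  "(circ has_vector_derivative 2 * of_real pi * \<i> * circ t) (at t within A)"
proof -
  have "((\<lambda>z. exp (2 * of_real pi * \<i> * z)) has_field_derivative
      2 * of_real pi * \<i> * exp (2 * of_real pi * \<i> * of_real t)) (at (of_real t))"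
    by (auto intro!: derivative_eq_intros)
  from has_vector_derivative_real_field[OF this]
  show ?thesis by (simp add: circ_conv_exp[abs_def])
qed

section \<open>Cauchy, Poisson and derivative kernels on the circle\<close>

lemma has_contour_integral_unit_circle:
  "(f has_contour_integral I) (circlepath 0 1) \<longleftrightarrow>
   ((\<lambda>t. f (circ t) * circ t) has_integral (I / (2 * of_real pi * \<i>))) {0..1}"
proof -
  have "(f has_contour_integral I) (circlepath 0 1) \<longleftrightarrow>
      ((\<lambda>t. (2 * of_real pi * \<i>) * (f (circ t) * circ t)) has_integral I) {0..1}"
    unfolding has_contour_integral
    by (intro has_integral_cong) (simp add: vector_derivative_circlepath circlepath[THEN fun_cong] circ_conv_exp)
  also have "\<dots> \<longleftrightarrow> ((\<lambda>t. f (circ t) * circ t) has_integral (I / (2 * of_real pi * \<i>))) {0..1}"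
  proof
    assume "((\<lambda>t. (2 * of_real pi * \<i>) * (f (circ t) * circ t)) has_integral I) {0..1}"
    from has_integral_mult_right[OF this, of "1 / (2 * of_real pi * \<i>)"]
    show "((\<lambda>t. f (circ t) * circ t) has_integral (I / (2 * of_real pi * \<i>))) {0..1}" by simp
  next
    assume "((\<lambda>t. f (circ t) * circ t) has_integral (I / (2 * of_real pi * \<i>))) {0..1}"
    from has_integral_mult_right[OF this, of "2 * of_real pi * \<i>"]
    show "((\<lambda>t. (2 * of_real pi * \<i>) * (f (circ t) * circ t)) has_integral I) {0..1}" by simp
  qed
  finally show ?thesis .
qed

lemma Cauchy_integral_unit_circle:
  assumes "continuous_on (cball 0 1) f" "f holomorphic_on ball 0 1" "norm w < 1"
  shows "((\<lambda>t. f (circ t) * circ t / (circ t - w)) has_integral f w) {0..1}"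
  using Cauchy_integral_circlepath[OF assms(1,2), of w] assms(3)
  by (simp add: has_contour_integral_unit_circle)

text \<open>Cauchy's formula at the point \<open>- r\<close>, applied to a rational function
  \<open>f\<close> with its only pole at \<open>- 1 / r\<close>, outside the disc. Since
  \<open>cnj (circ t)\<close> is the inverse of \<open>circ t\<close>, the integrand is the Poisson
  kernel, and \<open>f\<close> takes the value 1 at \<open>- r\<close>.\<close>

lemma has_integral_Poisson_kernel:
  fixes r :: real
  assumes "0 < r" "r < 1"
  shows "((\<lambda>t. (1 - r\<^sup>2) / (norm (circ t + of_real r))\<^sup>2) has_integral 1) {0..1}"
proof -
  have r2: "r\<^sup>2 < 1" using assms by (simp add: power_less_one_iff)
  have nz: "1 + of_real r * z \<noteq> 0" if "norm z \<le> 1" for z :: complex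
  proof
    assume "1 + of_real r * z = 0"
    then have "of_real r * z = - 1" by (simp add: add_eq_0_iff)
    then have "r * norm z = 1" using assms by (metis norm_minus_cancel norm_mult norm_of_real norm_one abs_of_pos)
    moreover have "r * norm z \<le> r" using that assms by (simp add: mult_left_le)
    ultimately show False using assms by simp
  qed
  define f :: "complex \<Rightarrow> complex" where "f = (\<lambda>z. (1 - of_real (r\<^sup>2)) / (1 + of_real r * z))"
  have "((\<lambda>t. f (circ t) * circ t / (circ t - (- of_real r))) has_integral f (- of_real r)) {0..1}"
  proof (rule Cauchy_integral_unit_circle)
    show "continuous_on (cball 0 1) f"
      unfolding f_def by (intro continuous_intros) (auto simp: nz)
    show "f holomorphic_on ball 0 1"
      unfolding f_def by (intro holomorphic_intros) (auto simp: nz)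
  qed (use assms in auto)
  moreover have "f (- of_real r) = 1"
    using r2 unfolding f_def
    by (metis (no_types, lifting) diff_conv_add_uminus divide_self_if eq_iff_diff_eq_0 mult_minus_right
        of_real_1 of_real_diff of_real_eq_0_iff of_real_mult order_less_irrefl power2_eq_square)
  moreover have "f (circ t) * circ t / (circ t - (- of_real r))
      = of_real ((1 - r\<^sup>2) / (norm (circ t + of_real r))\<^sup>2)" for t
  proof -
    have c: "circ t * cnj (circ t) = 1" by (simp add: circ_def cis_cnj cis_mult)
    have "of_real ((norm (circ t + of_real r))\<^sup>2) = (circ t + of_real r) * (cnj (circ t) + of_real r)"
      using complex_norm_square[of "circ t + of_real r"] by simp
    then have "circ t * of_real ((norm (circ t + of_real r))\<^sup>2) = (circ t + of_real r) * (1 + of_real r * circ t)"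
      using c by (simp add: algebra_simps)
    moreover have "circ t + of_real r \<noteq> 0"
      using assms norm_circ[of t] by (metis abs_of_pos add_eq_0_iff less_irrefl norm_minus_cancel norm_of_real)
    ultimately show ?thesis using nz[of "circ t"] unfolding f_def
      by (simp add: divide_simps)
  qed
  ultimately have "((\<lambda>t. complex_of_real ((1 - r\<^sup>2) / (norm (circ t + of_real r))\<^sup>2)) has_integral of_real 1) {0..1}"
    by simp
  from has_integral_Re[OF this] show ?thesis by simp
qed

text \<open>Jordan's inequality: a concave function lies above its chord.\<close>

lemma sin_ge_chord:
  assumes "0 \<le> x" "x \<le> pi / 2"
  shows "2 * x / pi \<le> sin x"
proof -
  have "concave_on {0..pi/2} (sin :: real \<Rightarrow> real)"
    by (rule f''_le0_imp_concave[where f' = cos and f'' = "\<lambda>x. - sin x"])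
      (auto intro!: derivative_eq_intros sin_ge_zero)
  from concave_onD[OF this, of "2 * x / pi" 0 "pi/2"] assms show ?thesis
    by (simp add: field_simps)
qed

text \<open>The chord from \<open>circ t\<close> to -1 has length \<open>2 * sin u\<close> with
  \<open>u = pi * \<bar>t - 1 / 2\<bar>\<close>, so Jordan's inequality bounds it below by the
  distance of the parameters.\<close>

lemma norm_circ_add_1_ge:
  assumes "0 \<le> t" "t \<le> 1"
  shows "4 * \<bar>t - 1 / 2\<bar> \<le> norm (circ t + 1)"
proof -
  define u where "u = pi * \<bar>t - 1 / 2\<bar>"
  have u: "0 \<le> u" "u \<le> pi / 2" using assms by (auto simp: u_def abs_if field_simps)
  have "cos (2 * pi * t) = - cos (2 * u)"
    by (auto simp: u_def abs_if cos_diff algebra_simps)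
  then have c: "cos (2 * pi * t) = 2 * (sin u)\<^sup>2 - 1"
    by (simp add: cos_double_sin)
  have "(norm (circ t + 1))\<^sup>2 = (cos (2 * pi * t) + 1)\<^sup>2 + (sin (2 * pi * t))\<^sup>2"
    by (simp add: circ_def cmod_power2)
  also have "\<dots> = 2 + 2 * cos (2 * pi * t)"
    using sin_cos_squared_add[of "2 * pi * t"] by (simp add: power2_eq_square algebra_simps)
  also have "\<dots> = (2 * sin u)\<^sup>2" by (simp add: c power_mult_distrib)
  finally have "norm (circ t + 1) = \<bar>2 * sin u\<bar>"
    by (metis abs_norm_cancel power2_eq_iff_nonneg abs_ge_zero power2_abs)
  moreover have "2 * u / pi \<le> sin u" by (rule sin_ge_chord[OF u])
  ultimately show ?thesis by (auto simp: u_def)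
qed

lemma has_integral_norm_le:
  fixes f :: "'n::euclidean_space \<Rightarrow> 'a::banach"
  assumes "(f has_integral I) S" "(g has_integral J) S" "\<And>x. x \<in> S \<Longrightarrow> norm (f x) \<le> g x"
  shows "norm I \<le> J"
  using Henstock_Kurzweil_Integration.integral_norm_bound_integral[of f S g] assms
  by (metis has_integral_integrable integral_unique)

text \<open>The derivative of \<open>K\<close> is represented by the difference of the Cauchy kernels of the point
  and of its reflection \<open>1 / w\<close>: its decay \<open>(1 - r\<^sup>2) / \<bar>z - w\<bar>\<^sup>3\<close> is one order better than that
  of a single Cauchy kernel.\<close>

lemma has_integral_derivative_kernel:
  fixes r :: real and K k :: "complex \<Rightarrow> complex"
  assumes r: "0 < r" "r < 1" and R: "1 < R"
    and K: "\<And>z. z \<in> ball 0 R \<Longrightarrow> (K has_field_derivative k z) (at z)"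
  shows "((\<lambda>t. K (circ t) * (1 / (circ t + of_real r)\<^sup>2 - 1 / (circ t + of_real (1 / r))\<^sup>2) * circ t)
            has_integral k (- of_real r)) {0..1}"
proof -
  define w where "w = - complex_of_real r"
  define v where "v = - complex_of_real (1 / r)"
  have nv: "norm v = 1 / r" and nw: "norm w = r" using r by (simp_all add: v_def w_def norm_divide)
  have holK: "K holomorphic_on ball 0 R"
    using K by (intro holomorphic_onI) (auto simp: field_differentiable_def intro: has_field_derivative_at_within)
  have contK: "continuous_on (cball 0 1) K"
    using holK R by (intro holomorphic_on_imp_continuous_on) (auto intro: holomorphic_on_subset)
  have holK1: "K holomorphic_on ball 0 1"
    using holK R by (auto intro: holomorphic_on_subset)
  have win: "w \<in> ball 0 1" using r by (simp add: w_def)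
  note D = Cauchy_derivative_integral_circlepath[OF contK holK1 win]
  have "w \<in> ball 0 R" using R r by (simp add: w_def)
  from DERIV_unique[OF K[OF this] D(2)]
  have kw: "contour_integral (circlepath 0 1) (\<lambda>u. K u / (u - w)\<^sup>2) = 2 * of_real pi * \<i> * k w"
    by (simp add: field_simps)
  have 1: "((\<lambda>u. K u / (u - w)\<^sup>2) has_contour_integral (2 * of_real pi * \<i> * k w)) (circlepath 0 1)"
    using has_contour_integral_integral[OF D(1)] kw by simp
  \<comment> \<open>The reflected pole \<open>v\<close> lies outside an open disc that still
    contains the closed unit disc, so subtracting its kernel does not change the value of the
    integral.\<close>
  have 2: "((\<lambda>u. K u / (u - v)\<^sup>2) has_contour_integral 0) (circlepath 0 1)"
  proof (rule Cauchy_theorem_disc_simple[of _ 0 "min R (1 / r)"])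
    have "u \<noteq> v" if "u \<in> ball 0 (min R (1 / r))" for u
      using that nv by auto
    then show "(\<lambda>u. K u / (u - v)\<^sup>2) holomorphic_on ball 0 (min R (1 / r))"
      by (intro holomorphic_intros holomorphic_on_subset[OF holK]) auto
    have "1 < min R (1 / r)" using R r by (simp add: field_simps)
    then show "path_image (circlepath 0 1) \<subseteq> ball 0 (min R (1 / r))"
      by auto
  qed auto
  from has_contour_integral_diff[OF 1 2]
  have "((\<lambda>t. (K (circ t) / (circ t - w)\<^sup>2 - K (circ t) / (circ t - v)\<^sup>2) * circ t) has_integral k w) {0..1}"
    by (simp add: has_contour_integral_unit_circle)
  then show ?thesis by (simp add: w_def v_def algebra_simps)
qed

text \<open>The two poles are reflections of each other in the circle, hence the distances of
  \<open>circ t\<close> from them differ by the factor \<open>r\<close>. Factoring the difference of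
  reciprocal squares exposes the distance \<open>1 / r - r\<close> of the poles, which supplies the
  factor \<open>1 - r\<^sup>2\<close> of the Poisson kernel.\<close>

lemma derivative_kernel_bound:
  fixes r :: real
  assumes r: "0 < r" "r < 1"
  shows "norm (1 / (circ t + of_real r)\<^sup>2 - 1 / (circ t + of_real (1 / r))\<^sup>2)
      \<le> 2 * (1 - r\<^sup>2) / (norm (circ t + of_real r)) ^ 3"
proof -
  define a b where "a = circ t + of_real r" and "b = circ t + of_real (1 / r)"
  define N where "N = norm a"
  have c: "circ t * cnj (circ t) = 1" by (simp add: circ_def cis_cnj cis_mult)
  have "of_real r * b = circ t * cnj a"
    using r c by (simp add: a_def b_def algebra_simps)
  then have "norm (of_real r * b) = norm (circ t * cnj a)" by (rule arg_cong)
  then have "r * norm b = N" using r unfolding norm_mult complex_mod_cnj by (simp add: N_def)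
  then have nb: "norm b = N / r" using r by (simp add: field_simps)
  have "a \<noteq> 0"
    using r norm_circ[of t] unfolding a_def
    by (metis abs_of_pos add_eq_0_iff less_irrefl norm_minus_cancel norm_of_real)
  then have N: "N > 0" by (simp add: N_def)
  then have "b \<noteq> 0" using nb r by auto
  have le: "norm (b + a) \<le> N / r + N" using norm_triangle_ineq[of b a] nb by (simp add: N_def)
  have "r < 1 / r" using r by (simp add: field_simps power2_eq_square[symmetric] power_less_one_iff)
  have "norm (b - a) = 1 / r - r"
  proof -
    have "b - a = of_real (1 / r - r)" by (simp add: a_def b_def)
    then show ?thesis using \<open>r < 1 / r\<close> by (metis abs_of_pos diff_gt_0_iff_gt norm_of_real)
  qed
  moreover have "1 / a\<^sup>2 - 1 / b\<^sup>2 = (b - a) * (b + a) / (a\<^sup>2 * b\<^sup>2)"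
    using \<open>a \<noteq> 0\<close> \<open>b \<noteq> 0\<close> by (simp add: divide_simps power2_eq_square algebra_simps)
  ultimately have "norm (1 / a\<^sup>2 - 1 / b\<^sup>2) = (1 / r - r) * norm (b + a) / (N\<^sup>2 * (N / r)\<^sup>2)"
    by (simp only: norm_mult norm_divide norm_power nb N_def[symmetric])
  also have "\<dots> \<le> (1 / r - r) * (N / r + N) / (N\<^sup>2 * (N / r)\<^sup>2)"
    by (intro divide_right_mono mult_left_mono le) (use \<open>r < 1 / r\<close> in auto)
  also have "\<dots> = (1 + r) * (1 - r\<^sup>2) / N ^ 3"
    using r N by (simp add: divide_simps power2_eq_square power3_eq_cube) (simp add: algebra_simps)
  also have "\<dots> \<le> 2 * (1 - r\<^sup>2) / N ^ 3"
    using r N by (intro divide_right_mono mult_right_mono) (auto simp: power_le_one)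
  finally show ?thesis by (simp add: a_def b_def N_def)
qed

text \<open>The radial maximal function is dominated by the Hardy-Littlewood maximal function; the base
  point on the circle is \<open>-1 = circ (1 / 2)\<close>, the midpoint of the parameter interval.\<close>

lemma radial_bound_by_averages:
  fixes k :: "complex \<Rightarrow> complex" and r A :: real
  assumes k: "k holomorphic_on ball 0 R" and R: "1 < R" and r: "0 < r" "r < 1"
    and A: "\<And>d. 0 < d \<Longrightarrow> d \<le> 1 / 2 \<Longrightarrow>
        integral {1 / 2 - d..1 / 2 + d} (\<lambda>t. norm (k (circ t))) \<le> A * d"
  shows "norm (k (- of_real r)) \<le> 2 * pi * A"
proof -
  obtain K0 where K0: "\<And>z. z \<in> ball 0 R \<Longrightarrow> (K0 has_field_derivative k z) (at z within ball 0 R)"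
    by (rule holomorphic_convex_primitive'[OF convex_ball open_ball k], rule that) blast
  \<comment> \<open>Normalising the primitive to vanish at the base point turns the bound on
    averages of \<open>k\<close> into linear growth of \<open>K\<close> along the circle.\<close>
  define K where "K z = K0 z - K0 (-1)" for z
  have K: "(K has_field_derivative k z) (at z)" if "z \<in> ball 0 R" for z
  proof -
    have "(K0 has_field_derivative k z) (at z)"
      using K0[OF that] at_within_open[OF that open_ball] by simp
    from DERIV_diff[OF this DERIV_const[of "K0 (-1)"]] show ?thesis by (simp add: K_def[abs_def])
  qed
  have cin: "circ t \<in> ball 0 R" for t using R by simp
  have contk: "continuous_on S (\<lambda>t. k (circ t))" for S
  proof -
    have 1: "continuous_on S circ" using continuous_on_circ[OF continuous_on_id] by simp
    have 2: "circ ` S \<subseteq> ball 0 R" using cin by blast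
    show ?thesis
      using continuous_on_compose[OF 1 continuous_on_subset[OF holomorphic_on_imp_continuous_on[OF k] 2]]
      by (simp add: o_def)
  qed
  have increment: "norm (K (circ b) - K (circ a)) \<le> 2 * pi * integral {a..b} (\<lambda>t. norm (k (circ t)))"
    if "a \<le> b" for a b
  proof -
    have "((\<lambda>t. 2 * of_real pi * \<i> * circ t * k (circ t)) has_integral (K (circ b) - K (circ a))) {a..b}"
    proof (rule fundamental_theorem_of_calculus[OF that])
      fix x assume "x \<in> {a..b}"
      have "((K \<circ> circ) has_vector_derivative 2 * of_real pi * \<i> * circ x * k (circ x)) (at x)"
        by (rule field_vector_diff_chain_at[OF has_vector_derivative_circ K[OF cin]])
      then show "((\<lambda>t. K (circ t)) has_vector_derivative 2 * of_real pi * \<i> * circ x * k (circ x)) (at x within {a..b})"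
        by (simp add: o_def has_vector_derivative_at_within)
    qed
    moreover have "((\<lambda>t. 2 * pi * norm (k (circ t))) has_integral
        (2 * pi * integral {a..b} (\<lambda>t. norm (k (circ t))))) {a..b}"
      by (intro has_integral_mult_right integrable_integral integrable_continuous_real
          continuous_on_norm contk)
    ultimately show ?thesis by (rule has_integral_norm_le) (simp add: norm_mult)
  qed
  have ab: "norm (K (circ t)) \<le> 2 * pi * A * \<bar>t - 1 / 2\<bar>" if t: "t \<in> {0..1}" for t
  proof (cases "t = 1 / 2")
    case True then show ?thesis unfolding True circ_half K_def by simp
  next
    case False
    define d where "d = \<bar>t - 1 / 2\<bar>"
    have d: "0 < d" "d \<le> 1 / 2" using False t by (auto simp: d_def abs_if)
    have ib: "integral {min t (1 / 2)..max t (1 / 2)} (\<lambda>t. norm (k (circ t))) \<le> A * d"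
      by (rule order_trans[OF integral_subset_le A[OF d]])
        (auto simp: d_def intro!: integrable_continuous_real continuous_on_norm contk)
    have "norm (K (circ t)) = norm (K (circ (max t (1 / 2))) - K (circ (min t (1 / 2))))"
      by (simp add: min_def max_def K_def norm_minus_commute)
    also have "\<dots> \<le> 2 * pi * integral {min t (1 / 2)..max t (1 / 2)} (\<lambda>t. norm (k (circ t)))"
      by (rule increment) simp
    also have "\<dots> \<le> 2 * pi * (A * d)" using ib by (intro mult_left_mono) auto
    finally show ?thesis by (simp add: d_def)
  qed
  have A0: "0 \<le> A"
  proof -
    have "0 \<le> integral {1 / 2 - 1 / 2..1 / 2 + 1 / 2} (\<lambda>t. norm (k (circ t)))"
      by (intro integral_nonneg integrable_continuous_real continuous_on_norm contk) auto
    also have "\<dots> \<le> A * (1 / 2)" by (rule A) auto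
    finally show ?thesis by simp
  qed
  note P = has_integral_Poisson_kernel[OF r]
  have r2: "r\<^sup>2 < 1" using r by (simp add: power_less_one_iff)
  have "norm (k (- of_real r)) \<le> 2 * pi * A * 1"
  proof (rule has_integral_norm_le[OF has_integral_derivative_kernel[OF r R K] has_integral_mult_right[OF P]])
    fix t :: real assume t: "t \<in> {0..1}"
    \<comment> \<open>\<open>N\<close> dominates both \<open>1 - r\<close> and twice the parameter
      distance from the base point. The linear growth of \<open>K\<close> therefore cancels one of
      the three powers of \<open>N\<close> in the kernel bound, and what remains is a multiple of
      the Poisson kernel, whose integral is 1.\<close>
    define N where "N = norm (circ t + of_real r)"
    have "circ t + of_real r \<noteq> 0"
      using r norm_circ[of t]
      by (metis abs_of_pos add_eq_0_iff less_irrefl norm_minus_cancel norm_of_real)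
    then have N: "N > 0" by (simp add: N_def)
    have "1 - r \<le> N" using norm_triangle_ineq2[of "circ t" "- of_real r"] r by (simp add: N_def)
    moreover have "norm (circ t + 1) \<le> N + (1 - r)"
      using norm_triangle_ineq[of "circ t + of_real r" "of_real (1 - r)"] r
      unfolding N_def norm_of_real by simp
    ultimately have "2 * \<bar>t - 1 / 2\<bar> \<le> N" using norm_circ_add_1_ge[of t] t by auto
    then have "pi * A * (2 * \<bar>t - 1 / 2\<bar>) \<le> pi * A * N" by (intro mult_left_mono) (auto simp: A0)
    moreover have "norm (K (circ t)) \<le> pi * A * (2 * \<bar>t - 1 / 2\<bar>)" using ab[OF t] by simp
    ultimately have KN: "norm (K (circ t)) \<le> pi * A * N" by (rule order_trans[rotated])
    have "norm (K (circ t) * (1 / (circ t + of_real r)\<^sup>2 - 1 / (circ t + of_real (1 / r))\<^sup>2) * circ t)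
        \<le> pi * A * N * (2 * (1 - r\<^sup>2) / N ^ 3)"
      unfolding norm_mult norm_circ mult_1_right
      by (intro mult_mono KN derivative_kernel_bound[OF r, of t, folded N_def] norm_ge_zero)
        (use A0 N in auto)
    also have "\<dots> = 2 * pi * A * ((1 - r\<^sup>2) / N\<^sup>2)"
      using N by (simp add: power2_eq_square power3_eq_cube)
    finally show "norm (K (circ t) * (1 / (circ t + of_real r)\<^sup>2 - 1 / (circ t + of_real (1 / r))\<^sup>2) * circ t)
        \<le> 2 * pi * A * ((1 - r\<^sup>2) / (norm (circ t + of_real r))\<^sup>2)" by (simp only: N_def)
  qed
  then show ?thesis by simp
qed

subsection \<open>A maximal inequality on the circle\<close>

text \<open>Vitali's covering lemma selects disjoint intervals whose fivefold enlargements cover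
  \<open>E\<close>. An enlarged interval has length \<open>10 * d t\<close>, at most
  \<open>10 / c\<close> times the integral over the original one, and disjointness allows these
  integrals to be added. The windows may leave \<open>{0..1}\<close> by 1/2 on either side. A
  measurable cover is returned because \<open>E\<close> is an arbitrary set.\<close>

lemma Hardy_Littlewood_weak_type:
  fixes \<phi> d :: "real \<Rightarrow> real"
  assumes cont: "continuous_on UNIV \<phi>" and nonneg: "\<And>t. 0 \<le> \<phi> t" and c: "0 < c"
    and E: "E \<subseteq> {0..1}"
    and d: "\<And>t. t \<in> E \<Longrightarrow> 0 < d t \<and> d t \<le> 1 / 2 \<and> c * d t \<le> integral {t - d t..t + d t} \<phi>"
  obtains T where "E \<subseteq> T" "T \<in> lmeasurable" "measure lebesgue T \<le> 10 / c * integral {- 1 / 2..3 / 2} \<phi>"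
proof -
  have E': "E \<subseteq> (\<Union>t\<in>E. cball t (d t))" using d by (force simp: less_imp_le)
  obtain C where C: "countable C" "C \<subseteq> E"
    "pairwise (\<lambda>i j. disjnt (cball i (d i)) (cball j (d j))) C" "E \<subseteq> (\<Union>i\<in>C. cball i (5 * d i))"
    by (rule Vitali_covering_lemma_cballs[OF E', of "1 / 2"]) (use d in auto)
  have int: "\<phi> integrable_on {a..b}" for a b
    by (intro integrable_continuous_real continuous_on_subset[OF cont]) auto
  have bound: "measure lebesgue (\<Union>i\<in>F. cball i (5 * d i)) \<le> 10 / c * integral {- 1 / 2..3 / 2} \<phi>"
    if F: "F \<subseteq> C" "finite F" for F
  proof -
    have dF: "0 < d i \<and> d i \<le> 1 / 2 \<and> c * d i \<le> integral {i - d i..i + d i} \<phi>" "i \<in> {0..1}" if "i \<in> F" for i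
      using that F C d E by blast+
    have le: "(\<Sum>i\<in>F. integral {i - d i..i + d i} \<phi>) \<le> integral {- 1 / 2..3 / 2} \<phi>"
    proof (rule has_integral_subset_le)
      show "(\<phi> has_integral (\<Sum>i\<in>F. integral {i - d i..i + d i} \<phi>)) (\<Union>i\<in>F. {i - d i..i + d i})"
      proof (rule has_integral_UN[OF F(2)])
        show "pairwise (\<lambda>i i'. negligible ({i - d i..i + d i} \<inter> {i' - d i'..i' + d i'})) F"
          using pairwise_subset[OF C(3) F(1)]
          by (auto simp: pairwise_def disjnt_def cball_eq_atLeastAtMost)
      qed (use int in \<open>auto intro: integrable_integral\<close>)
      show "(\<Union>i\<in>F. {i - d i..i + d i}) \<subseteq> {- 1 / 2..3 / 2}"
        using dF by force
    qed (use int nonneg in \<open>auto intro: integrable_integral\<close>)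
    have "measure lebesgue (\<Union>i\<in>F. cball i (5 * d i)) \<le> (\<Sum>i\<in>F. measure lebesgue (cball i (5 * d i)))"
      by (rule measure_UNION_le) (use F in auto)
    also have "\<dots> = (\<Sum>i\<in>F. 10 * d i)"
      using dF by (intro sum.cong) (auto simp: cball_eq_atLeastAtMost less_imp_le)
    also have "\<dots> \<le> (\<Sum>i\<in>F. 10 / c * integral {i - d i..i + d i} \<phi>)"
      using dF c by (intro sum_mono) (auto simp: field_simps)
    also have "\<dots> = 10 / c * (\<Sum>i\<in>F. integral {i - d i..i + d i} \<phi>)"
      by (simp add: sum_distrib_left)
    also have "\<dots> \<le> 10 / c * integral {- 1 / 2..3 / 2} \<phi>"
      using c by (intro mult_left_mono le) auto
    finally show ?thesis .
  qed
  show thesis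
  proof (rule that[OF C(4)])
    show "(\<Union>i\<in>C. cball i (5 * d i)) \<in> lmeasurable"
      by (rule fmeasurable_UN_bound[OF C(1) _ bound]) auto
    show "measure lebesgue (\<Union>i\<in>C. cball i (5 * d i)) \<le> 10 / c * integral {- 1 / 2..3 / 2} \<phi>"
      by (rule measure_UN_bound[OF C(1) _ bound]) auto
  qed
qed

lemma circ_add_1 [simp]: "circ (t + 1) = circ t"
  by (simp add: circ_add)

lemma integral_periodic_double:
  fixes \<phi> :: "real \<Rightarrow> real"
  assumes cont: "continuous_on UNIV \<phi>" and per: "\<And>t. \<phi> (t + 1) = \<phi> t"
  shows "integral {- 1 / 2..3 / 2} \<phi> = 2 * integral {0..1} \<phi>"
proof -
  have int: "\<phi> integrable_on {a..b}" for a b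
    by (intro integrable_continuous_real continuous_on_subset[OF cont]) auto
  have shift: "integral {a..b} \<phi> = integral {a + 1..b + 1} \<phi>" for a b
    using integral_shift_real_ivl[of "a + 1" 1 "b + 1" \<phi>] per by simp
  have "integral {- 1 / 2..3 / 2} \<phi> = integral {- 1 / 2..0} \<phi> + integral {0..1} \<phi> + integral {1..3 / 2} \<phi>"
    using Henstock_Kurzweil_Integration.integral_combine[of "- 1 / 2" 1 "3 / 2" \<phi>]
      Henstock_Kurzweil_Integration.integral_combine[of "- 1 / 2" 0 1 \<phi>] int by simp
  also have "integral {- 1 / 2..0} \<phi> = integral {1 / 2..1} \<phi>" using shift[of "- 1 / 2" 0] by simp
  also have "integral {1..3 / 2} \<phi> = integral {0..1 / 2} \<phi>" using shift[of 0 "1 / 2"] by simp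
  also have "integral {1 / 2..1} \<phi> + integral {0..1} \<phi> + integral {0..1 / 2} \<phi> = 2 * integral {0..1} \<phi>"
    using Henstock_Kurzweil_Integration.integral_combine[of 0 "1 / 2" 1 \<phi>] int by simp
  finally show ?thesis .
qed

text \<open>The radial bound is read contrapositively: where the maximal function exceeds
  \<open>2 * pi * c\<close>, some symmetric average is large. The constant 20 is the 10 of the
  covering argument times the two periods in the enlarged window.\<close>

lemma radial_maximal_weak_type:
  fixes k :: "complex \<Rightarrow> complex"
  assumes k: "k holomorphic_on ball 0 R" and R: "1 < R" and c: "0 < c"
  defines "E \<equiv> {t \<in> {0..1}. \<exists>r\<in>{0<..<1}. 2 * pi * c < norm (k (of_real r * circ t))}"
  shows "E \<in> lmeasurable" "measure lebesgue E \<le> 20 / c * integral {0..1} (\<lambda>t. norm (k (circ t)))"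
proof -
  have contk: "continuous_on (ball 0 R) k" by (rule holomorphic_on_imp_continuous_on[OF k])
  have contr: "continuous_on UNIV (\<lambda>t. norm (k (of_real r * circ t)))" if "\<bar>r\<bar> \<le> 1" for r
  proof -
    have "(\<lambda>t. of_real r * circ t) ` UNIV \<subseteq> ball 0 R"
      using that R by (auto simp: norm_mult)
    moreover have "continuous_on UNIV (\<lambda>t. of_real r * circ t)" by (intro continuous_intros)
    ultimately have "continuous_on UNIV (\<lambda>t. k (of_real r * circ t))"
      using continuous_on_compose continuous_on_subset[OF contk] unfolding o_def by blast
    then show ?thesis by (rule continuous_on_norm)
  qed
  define \<phi> where "\<phi> t = norm (k (circ t))" for t
  have cont: "continuous_on UNIV \<phi>" using contr[of 1] by (simp add: \<phi>_def[abs_def])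
  have avg: "\<exists>d. 0 < d \<and> d \<le> 1 / 2 \<and> c * d \<le> integral {t - d..t + d} \<phi>" if "t \<in> E" for t
  proof (rule ccontr)
    assume neg: "\<not> ?thesis"
    obtain r where r: "0 < r" "r < 1" "2 * pi * c < norm (k (of_real r * circ t))"
      using \<open>t \<in> E\<close> by (auto simp: E_def)
    \<comment> \<open>This rotation moves the radius through \<open>circ t\<close> to the negative
      real axis, where the radial bound is stated: \<open>k' (- r)\<close> is the value of
      \<open>k\<close> at \<open>r * circ t\<close>.\<close>
    define k' where "k' z = k (- circ t * z)" for z
    have "k' holomorphic_on ball 0 R"
    proof -
      have "(\<lambda>z. - circ t * z) ` ball 0 R \<subseteq> ball 0 R" by (auto simp: norm_mult)
      from holomorphic_on_compose[OF _ holomorphic_on_subset[OF k this]]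
      show ?thesis unfolding k'_def o_def by (auto intro!: holomorphic_intros)
    qed
    moreover have "integral {1 / 2 - d..1 / 2 + d} (\<lambda>s. norm (k' (circ s))) \<le> c * d"
      if "0 < d" "d \<le> 1 / 2" for d
    proof -
      have "circ (s + (t - 1 / 2)) = - circ t * circ s" for s
      proof -
        have "circ (s + (t - 1 / 2)) = circ ((s + (t - 1 / 2)) + 1)" by (rule circ_add_1[symmetric])
        also have "(s + (t - 1 / 2)) + 1 = 1 / 2 + (t + s)" by simp
        finally show ?thesis unfolding circ_add circ_half by simp
      qed
      then have "(\<lambda>s. norm (k' (circ s))) = (\<lambda>s. \<phi> (s + (t - 1 / 2)))"
        by (simp add: k'_def \<phi>_def fun_eq_iff)
      then have "integral {1 / 2 - d..1 / 2 + d} (\<lambda>s. norm (k' (circ s))) = integral {t - d..t + d} \<phi>"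
        using integral_shift_real_ivl[of "t - d" "t - 1 / 2" "t + d" \<phi>] by (simp add: add.commute[of d])
      then show ?thesis using neg that by force
    qed
    ultimately have "norm (k' (- of_real r)) \<le> 2 * pi * c"
      using R r(1,2) by (intro radial_bound_by_averages)
    then show False using r(3) by (simp add: k'_def mult.commute)
  qed
  then obtain d where d: "\<And>t. t \<in> E \<Longrightarrow> 0 < d t \<and> d t \<le> 1 / 2 \<and> c * d t \<le> integral {t - d t..t + d t} \<phi>"
    by metis
  have nonneg: "0 \<le> \<phi> t" for t by (simp add: \<phi>_def)
  have E01: "E \<subseteq> {0..1}" by (auto simp: E_def)
  obtain T where T: "E \<subseteq> T" "T \<in> lmeasurable" "measure lebesgue T \<le> 10 / c * integral {- 1 / 2..3 / 2} \<phi>"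
    by (rule Hardy_Littlewood_weak_type[OF cont nonneg c E01 d])
  have "open (\<Union>r\<in>{0<..<1}. {t. 2 * pi * c < norm (k (of_real r * circ t))})"
    by (intro open_UN ballI open_Collect_less contr continuous_on_const) auto
  moreover have "E = {0..1} \<inter> (\<Union>r\<in>{0<..<1}. {t. 2 * pi * c < norm (k (of_real r * circ t))})"
    by (auto simp: E_def)
  ultimately show E: "E \<in> lmeasurable"
    by (metis bounded_closed_interval bounded_set_imp_lmeasurable bounded_Int borel_open
        sets.Int lborelD atLeastAtMost_borel sets_completionI_sets sets_lborel)
  have "integral {- 1 / 2..3 / 2} \<phi> = 2 * integral {0..1} \<phi>"
    by (rule integral_periodic_double[OF cont]) (simp add: \<phi>_def)
  then show "measure lebesgue E \<le> 20 / c * integral {0..1} (\<lambda>t. norm (k (circ t)))"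
    using measure_mono_fmeasurable[OF T(1) _ T(2)] T(3) E by (simp add: \<phi>_def[abs_def])
qed

subsection \<open>Square means of Taylor remainders\<close>

lemma has_integral_circ_power:
  fixes n :: int
  shows "((\<lambda>t. circ (of_int n * t)) has_integral (if n = 0 then 1 else 0)) {0..1}"
proof (cases "n = 0")
  case True then show ?thesis using has_integral_const_real[of "1::complex" 0 1] by simp
next
  case False
  have d: "((\<lambda>t. circ (of_int n * t)) has_vector_derivative
      of_int n * (2 * of_real pi * \<i> * circ (of_int n * t))) (at t within {0..1})" for t
  proof -
    have "((\<lambda>t. of_int n * t) has_vector_derivative of_int n) (at t within {0..1::real})"
      unfolding has_real_derivative_iff_has_vector_derivative[symmetric] by (rule DERIV_cmult_Id)
    from vector_diff_chain_within[OF this has_vector_derivative_circ]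
    show ?thesis by (simp add: o_def scaleR_conv_of_real)
  qed
  have "((\<lambda>t. of_int n * (2 * of_real pi * \<i> * circ (of_int n * t))) has_integral
      (circ (of_int n * 1) - circ (of_int n * 0))) {0..1}"
    by (rule fundamental_theorem_of_calculus[OF _ d]) simp
  moreover have "circ (of_int n * 1) = 1"
    using cis_multiple_2pi[of "of_int n"] by (simp add: circ_def)
  ultimately have "((\<lambda>t. of_int n * (2 * of_real pi * \<i> * circ (of_int n * t))) has_integral 0) {0..1}"
    by simp
  from has_integral_mult_right[OF this, of "1 / (of_int n * (2 * of_real pi * \<i>))"] False
  show ?thesis by simp
qed

text \<open>Expanding the square gives a double sum of which only the diagonal survives, since
  nonconstant characters have mean zero.\<close>

lemma has_integral_norm_square_circ_sum:
  fixes b :: "nat \<Rightarrow> complex"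
  assumes "finite A"
  shows "((\<lambda>t. (norm (\<Sum>n\<in>A. b n * circ t ^ n))\<^sup>2) has_integral (\<Sum>n\<in>A. (norm (b n))\<^sup>2)) {0..1}"
proof -
  have e: "circ t ^ n * cnj (circ t ^ m) = circ (of_int (int n - int m) * t)" for n m t
    by (simp add: circ_def Complex.DeMoivre cis_cnj cis_mult algebra_simps)
  have "((\<lambda>t. \<Sum>n\<in>A. \<Sum>m\<in>A. b n * cnj (b m) * circ (of_int (int n - int m) * t)) has_integral
      (\<Sum>n\<in>A. \<Sum>m\<in>A. b n * cnj (b m) * (if int n - int m = 0 then 1 else 0))) {0..1}"
    by (intro has_integral_sum assms has_integral_mult_right has_integral_circ_power)
  also have "(\<Sum>n\<in>A. \<Sum>m\<in>A. b n * cnj (b m) * (if int n - int m = 0 then 1 else 0)) = of_real (\<Sum>n\<in>A. (norm (b n))\<^sup>2)"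
    unfolding of_real_sum
  proof (rule sum.cong[OF refl])
    fix n assume "n \<in> A"
    have "(\<Sum>m\<in>A. b n * cnj (b m) * (if int n - int m = 0 then 1 else 0))
        = (\<Sum>m\<in>A. if m = n then b n * cnj (b n) else 0)"
      by (rule sum.cong) auto
    also have "\<dots> = b n * cnj (b n)" using \<open>n \<in> A\<close> assms by simp
    finally show "(\<Sum>m\<in>A. b n * cnj (b m) * (if int n - int m = 0 then 1 else 0)) = of_real ((norm (b n))\<^sup>2)"
      by (simp only: complex_norm_square)
  qed
  also have "(\<lambda>t. \<Sum>n\<in>A. \<Sum>m\<in>A. b n * cnj (b m) * circ (of_int (int n - int m) * t))
      = (\<lambda>t. of_real ((norm (\<Sum>n\<in>A. b n * circ t ^ n))\<^sup>2))"
  proof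
    fix t
    have "of_real ((norm (\<Sum>n\<in>A. b n * circ t ^ n))\<^sup>2)
        = (\<Sum>n\<in>A. \<Sum>m\<in>A. (b n * circ t ^ n) * cnj (b m * circ t ^ m))"
      by (simp only: complex_norm_square cnj_sum sum_product)
    also have "\<dots> = (\<Sum>n\<in>A. \<Sum>m\<in>A. b n * cnj (b m) * (circ t ^ n * cnj (circ t ^ m)))"
      by (simp add: mult_ac)
    finally show "(\<Sum>n\<in>A. \<Sum>m\<in>A. b n * cnj (b m) * circ (of_int (int n - int m) * t))
        = of_real ((norm (\<Sum>n\<in>A. b n * circ t ^ n))\<^sup>2)"
      by (simp only: e)
  qed
  finally have "((\<lambda>t. complex_of_real ((norm (\<Sum>n\<in>A. b n * circ t ^ n))\<^sup>2)) has_integral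
      of_real (\<Sum>n\<in>A. (norm (b n))\<^sup>2)) {0..1}" .
  from has_integral_Re[OF this] show ?thesis by (simp only: Re_complex_of_real)
qed

lemma tendsto_integral_norm_square:
  fixes F :: "nat \<Rightarrow> real \<Rightarrow> complex"
  assumes lim: "uniform_limit {a..b} F f sequentially" and cont: "\<And>n. continuous_on {a..b} (F n)"
  shows "(\<lambda>n. integral {a..b} (\<lambda>t. (norm (F n t))\<^sup>2)) \<longlonglongrightarrow> integral {a..b} (\<lambda>t. (norm (f t))\<^sup>2)"
proof -
  have "continuous_on {a..b} f"
    by (rule uniform_limit_theorem[OF _ lim]) (use cont in auto)
  then have b: "bounded ((\<lambda>t. norm (f t)) ` {a..b})"
    by (intro compact_imp_bounded compact_continuous_image continuous_on_norm) auto
  have u: "uniform_limit {a..b} (\<lambda>n t. norm (F n t)) (\<lambda>t. norm (f t)) sequentially"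
    using lim by (rule uniform_limit_norm)
  have "uniform_limit {a..b} (\<lambda>n t. norm (F n t) * norm (F n t)) (\<lambda>t. norm (f t) * norm (f t)) sequentially"
    by (rule bounded_bilinear.bounded_uniform_limit[OF bounded_bilinear_mult u u b b])
  then have "uniform_limit {a..b} (\<lambda>n t. (norm (F n t))\<^sup>2) (\<lambda>t. (norm (f t))\<^sup>2) sequentially"
    by (simp add: power2_eq_square)
  then obtain I J where IJ: "\<And>n. ((\<lambda>t. (norm (F n t))\<^sup>2) has_integral I n) {a..b}"
    "((\<lambda>t. (norm (f t))\<^sup>2) has_integral J) {a..b}" "I \<longlonglongrightarrow> J"
    by (rule uniform_limit_integral) (use cont in \<open>auto intro!: continuous_intros\<close>)
  have "(\<lambda>n. integral {a..b} (\<lambda>t. (norm (F n t))\<^sup>2)) = I"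
    by (intro ext integral_unique IJ)
  moreover have "integral {a..b} (\<lambda>t. (norm (f t))\<^sup>2) = J"
    by (intro integral_unique IJ)
  ultimately show ?thesis using IJ(3) by simp
qed

text \<open>One polynomial serves all radii: the squared coefficients are summable, and the factors
  \<open>(R\<^sup>2) ^ n\<close> can only shrink a tail. This uniformity stands in for a boundary
  function of \<open>h\<close>, whose existence is still to be proved.\<close>

lemma Taylor_tail_square_mean:
  fixes h :: "complex \<Rightarrow> complex"
  assumes h: "h holomorphic_on ball 0 1" and M: "\<And>z. z \<in> ball 0 1 \<Longrightarrow> norm (h z) \<le> M" and e: "0 < e"
  shows "\<exists>(a :: nat \<Rightarrow> complex) N. \<forall>R\<in>{0<..<1}.
      integral {0..1} (\<lambda>t. (norm (h (of_real R * circ t) - (\<Sum>n<N. a n * (of_real R * circ t) ^ n)))\<^sup>2) \<le> e"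
proof -
  define a where "a n = (deriv ^^ n) h 0 / fact n" for n
  have sums: "(\<lambda>n. a n * z ^ n) sums h z" if "norm z < 1" for z
    using holomorphic_power_series[OF h, of z] that by (simp add: a_def)
  have rad: "1 \<le> conv_radius a"
  proof (rule conv_radius_geI_ex')
    fix r :: real assume "0 < r" "ereal r < 1"
    then have "norm (complex_of_real r) < 1" by simp
    from sums_summable[OF sums[OF this]] show "summable (\<lambda>n. a n * of_real r ^ n)" .
  qed
  define f where "f R t = h (of_real R * circ t)" for R t
  define S where "S R A t = (\<Sum>n\<in>A. a n * (of_real R * circ t) ^ n)" for R A t
  have unif: "uniform_limit {0..1} (\<lambda>m. S R {..<m}) (f R) sequentially" if R: "0 < R" "R < 1" for R
  proof -
    have "ereal R < 1" using R by simp
    from less_le_trans[OF this rad] have "ereal R < conv_radius a" .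
    from powser_uniform_limit[OF this, of 0]
    have "uniform_limit (cball 0 R) (\<lambda>n x. \<Sum>i<n. a i * x ^ i) (\<lambda>x. \<Sum>i. a i * x ^ i) sequentially" by simp
    from uniform_limit_compose'[OF this, of "\<lambda>t. of_real R * circ t" "{0..1}"]
    have "uniform_limit {0..1} (\<lambda>m. S R {..<m}) (\<lambda>t. \<Sum>i. a i * (of_real R * circ t) ^ i) sequentially"
      using R by (simp add: S_def[abs_def] norm_mult)
    also have "(\<lambda>t. \<Sum>i. a i * (of_real R * circ t) ^ i) = f R"
      using R by (intro ext) (simp add: f_def sums_unique[OF sums, symmetric] norm_mult)
    finally show ?thesis .
  qed
  have intS: "integral {0..1} (\<lambda>t. (norm (S R A t))\<^sup>2) = (\<Sum>n\<in>A. (norm (a n))\<^sup>2 * (R\<^sup>2) ^ n)"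
    if "finite A" "0 < R" for A R
  proof -
    have "S R A = (\<lambda>t. \<Sum>n\<in>A. (a n * of_real R ^ n) * circ t ^ n)"
      by (simp add: S_def[abs_def] power_mult_distrib mult.assoc)
    then have "integral {0..1} (\<lambda>t. (norm (S R A t))\<^sup>2) = (\<Sum>n\<in>A. (norm (a n * of_real R ^ n))\<^sup>2)"
      using integral_unique[OF has_integral_norm_square_circ_sum[OF that(1), of "\<lambda>n. a n * of_real R ^ n"]]
      by simp
    also have "\<dots> = (\<Sum>n\<in>A. (norm (a n))\<^sup>2 * (R\<^sup>2) ^ n)"
    proof (rule sum.cong[OF refl])
      fix n
      have "(norm (a n * of_real R ^ n))\<^sup>2 = (norm (a n))\<^sup>2 * (\<bar>R\<bar> ^ n)\<^sup>2"
        by (simp add: norm_mult norm_power power_mult_distrib)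
      also have "(\<bar>R\<bar> ^ n)\<^sup>2 = (R\<^sup>2) ^ n" by (metis power2_abs power_commutes power_mult mult.commute)
      finally show "(norm (a n * of_real R ^ n))\<^sup>2 = (norm (a n))\<^sup>2 * (R\<^sup>2) ^ n" .
    qed
    finally show ?thesis .
  qed
  have contS: "continuous_on {0..1} (S R A)" for R A
    unfolding S_def[abs_def] by (intro continuous_intros)
  \<comment> \<open>For \<open>R < 1\<close> the weighted partial sum is at most the mean square of
    \<open>f R\<close>, hence at most \<open>M\<^sup>2\<close>; then \<open>R\<close> tends to 1 in
    a finite sum.\<close>
  have Bessel: "(\<Sum>n<m. (norm (a n))\<^sup>2) \<le> M\<^sup>2" for m
  proof (rule tendsto_upperbound)
    show "((\<lambda>R::real. \<Sum>n<m. (norm (a n))\<^sup>2 * (R\<^sup>2) ^ n) \<longlongrightarrow> (\<Sum>n<m. (norm (a n))\<^sup>2)) (at_left 1)"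
      by (auto intro!: tendsto_eq_intros)
    have *: "(\<Sum>n<m. (norm (a n))\<^sup>2 * (R\<^sup>2) ^ n) \<le> M\<^sup>2" if R: "0 < R" "R < 1" for R :: real
    proof -
      have "(\<Sum>n<m. (norm (a n))\<^sup>2 * (R\<^sup>2) ^ n) \<le> integral {0..1} (\<lambda>t. (norm (f R t))\<^sup>2)"
      proof (rule LIMSEQ_le_const[OF tendsto_integral_norm_square[OF unif[OF R] contS]], intro exI allI impI)
        fix j assume "m \<le> j"
        then show "(\<Sum>n<m. (norm (a n))\<^sup>2 * (R\<^sup>2) ^ n) \<le> integral {0..1} (\<lambda>t. (norm (S R {..<j} t))\<^sup>2)"
          using R by (subst intS) (auto intro!: sum_mono2)
      qed
      also have "\<dots> \<le> integral {0..1} (\<lambda>t::real. M\<^sup>2)"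
      proof (rule integral_le)
        have "continuous_on {0..1} (f R)"
          by (rule uniform_limit_theorem[OF _ unif[OF R]]) (use contS in auto)
        then show "(\<lambda>t. (norm (f R t))\<^sup>2) integrable_on {0..1}"
          by (intro integrable_continuous_real continuous_intros)
        show "(norm (f R t))\<^sup>2 \<le> M\<^sup>2" if "t \<in> {0..1}" for t
          unfolding f_def using R by (intro power_mono M) (auto simp: norm_mult)
      qed auto
      finally show ?thesis by simp
    qed
    show "\<forall>\<^sub>F R in at_left 1. (\<Sum>n<m. (norm (a n))\<^sup>2 * (R\<^sup>2) ^ n) \<le> M\<^sup>2"
      unfolding eventually_at_left_field by (rule exI[of _ 0]) (use * in auto)
  qed simp
  have "summable (\<lambda>n. (norm (a n))\<^sup>2)"
    by (rule summableI_nonneg_bounded[OF _ Bessel]) auto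
  then obtain N where N: "\<And>m n. N \<le> m \<Longrightarrow> norm (\<Sum>i = m..<n. (norm (a i))\<^sup>2) < e"
    using e unfolding summable_Cauchy by meson
  show ?thesis
  proof (intro exI ballI)
    fix R :: real assume "R \<in> {0<..<1}"
    then have R: "0 < R" "R < 1" by auto
    have diff: "S R {..<m + N} t - S R {..<N} t = S R {N..<m + N} t" for m t
    proof -
      have "{..<m + N} = {..<N} \<union> {N..<m + N}" by auto
      then show ?thesis by (simp add: S_def sum.union_disjoint ivl_disj_int)
    qed
    have "uniform_limit {0..1} (\<lambda>m. S R {..<m + N}) (f R) sequentially"
      by (rule filterlim_compose[OF unif[OF R] filterlim_add_const_nat_at_top])
    moreover have "uniform_limit {0..1} (\<lambda>m. S R {..<N}) (S R {..<N}) sequentially"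
      by (rule uniform_limit_const)
    ultimately have "uniform_limit {0..1} (\<lambda>m t. S R {..<m + N} t - S R {..<N} t) (\<lambda>t. f R t - S R {..<N} t) sequentially"
      by (rule uniform_limit_minus)
    then
    have "uniform_limit {0..1} (\<lambda>m. S R {N..<m + N}) (\<lambda>t. f R t - S R {..<N} t) sequentially"
      by (simp add: diff)
    from tendsto_integral_norm_square[OF this contS]
    have "integral {0..1} (\<lambda>t. (norm (f R t - S R {..<N} t))\<^sup>2) \<le> e"
    proof (rule LIMSEQ_le_const2, intro exI allI impI)
      fix m :: nat
      have "integral {0..1} (\<lambda>t. (norm (S R {N..<m + N} t))\<^sup>2) = (\<Sum>n = N..<m + N. (norm (a n))\<^sup>2 * (R\<^sup>2) ^ n)"
        using R by (intro intS) auto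
      also have "\<dots> \<le> (\<Sum>n = N..<m + N. (norm (a n))\<^sup>2)"
        using R by (intro sum_mono mult_left_le power_le_one) (auto simp: power_le_one)
      also have "\<dots> \<le> e" using N[of N "m + N"] by simp
      finally show "integral {0..1} (\<lambda>t. (norm (S R {N..<m + N} t))\<^sup>2) \<le> e" .
    qed
    then show "integral {0..1} (\<lambda>t. (norm (h (of_real R * circ t) - (\<Sum>n<N. a n * (of_real R * circ t) ^ n)))\<^sup>2) \<le> e"
      by (simp add: f_def S_def)
  qed
qed

subsection \<open>Fatou's theorem for the disc\<close>

text \<open>This form of the Cauchy criterion has countable outer quantifiers and a closed innermost
  condition. It serves to write a set of convergence by countable operations on closed sets, and to
  reduce Fatou's theorem to countably many tolerances.\<close>

lemma tendsto_at_left_1_iff_Cauchy: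
  fixes f :: "real \<Rightarrow> 'a::complete_space"
  shows "(\<exists>L. (f \<longlongrightarrow> L) (at_left 1)) \<longleftrightarrow>
    (\<forall>m::nat. \<exists>j::nat. \<forall>r\<in>{1 - 1 / (real j + 1)<..<1}. \<forall>q\<in>{1 - 1 / (real j + 1)<..<1}. dist (f r) (f q) \<le> 1 / (real m + 1))"
    (is "?L \<longleftrightarrow> (\<forall>m. \<exists>j. ?C m j)")
proof
  assume ?L
  then obtain L where L: "(f \<longlongrightarrow> L) (at_left 1)" by blast
  show "\<forall>m. \<exists>j. ?C m j"
  proof
    fix m :: nat
    have "0 < 1 / (real m + 1) / 2" by simp
    from tendstoD[OF L this] obtain b where b: "b < 1" "\<And>r. b < r \<Longrightarrow> r < 1 \<Longrightarrow> dist (f r) L < 1 / (real m + 1) / 2"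
      unfolding eventually_at_left_field by blast
    obtain j :: nat where "1 / (real j + 1) < 1 - b"
      using reals_Archimedean[of "1 - b"] b(1) by (auto simp: inverse_eq_divide add.commute)
    then have "b < r" if "r \<in> {1 - 1 / (real j + 1)<..<1}" for r using that by simp
    then have "?C m j"
      using b(2) by (meson dist_triangle_half_l greaterThanLessThan_iff less_imp_le)
    then show "\<exists>j. ?C m j" ..
  qed
next
  assume C: "\<forall>m. \<exists>j. ?C m j"
  \<comment> \<open>The offset 2 places \<open>u i\<close> strictly inside the open interval of
    every index \<open>j \<le> i\<close>.\<close>
  define u where "u i = 1 - 1 / (real i + 2)" for i :: nat
  have u: "u i \<in> {1 - 1 / (real j + 1)<..<1}" if "j \<le> i" for i j
    using that by (auto simp: u_def frac_less2)
  have "Cauchy (\<lambda>i. f (u i))"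
  proof (rule metric_CauchyI)
    fix e :: real assume "0 < e"
    then obtain m :: nat where m: "1 / (real m + 1) < e"
      using reals_Archimedean[of e] by (auto simp: inverse_eq_divide add.commute)
    obtain j where j: "?C m j" using C by blast
    show "\<exists>M. \<forall>i\<ge>M. \<forall>n\<ge>M. dist (f (u i)) (f (u n)) < e"
      using j u m by (meson le_less_trans)
  qed
  then obtain L where L: "(\<lambda>i. f (u i)) \<longlonglongrightarrow> L"
    using Cauchy_convergent_iff convergent_def by blast
  have "(f \<longlongrightarrow> L) (at_left 1)"
  proof (rule tendstoI)
    fix e :: real assume "0 < e"
    then obtain m :: nat where m: "1 / (real m + 1) < e"
      using reals_Archimedean[of e] by (auto simp: inverse_eq_divide add.commute)
    obtain j where j: "?C m j" using C by blast
    have "dist (f r) L \<le> 1 / (real m + 1)" if "r \<in> {1 - 1 / (real j + 1)<..<1}" for r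
    proof (rule LIMSEQ_le_const2[OF tendsto_dist[OF tendsto_const L]], intro exI allI impI)
      fix i assume "j \<le> i"
      then show "dist (f r) (f (u i)) \<le> 1 / (real m + 1)" using j u that by blast
    qed
    then have "\<forall>r>1 - 1 / (real j + 1). r < 1 \<longrightarrow> dist (f r) L < e"
      using m by (meson greaterThanLessThan_iff le_less_trans)
    then show "\<forall>\<^sub>F r in at_left 1. dist (f r) L < e"
      unfolding eventually_at_left_field by (intro exI[of _ "1 - 1 / (real j + 1)"]) auto
  qed
  then show ?L ..
qed

text \<open>Cauchy-Schwarz by way of the arithmetic-geometric mean: pointwise
  \<open>norm (f t)\<close> is at most its square divided by \<open>2 * s\<close>, plus
  \<open>s / 2\<close>, and both terms integrate to at most \<open>s / 2\<close>.\<close>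

lemma integral_norm_le_of_square:
  fixes f :: "real \<Rightarrow> complex"
  assumes cont: "continuous_on {0..1} f" and s: "0 < s"
    and sq: "integral {0..1} (\<lambda>t. (norm (f t))\<^sup>2) \<le> s\<^sup>2"
  shows "integral {0..1} (\<lambda>t. norm (f t)) \<le> s"
proof -
  have int: "(\<lambda>t. (norm (f t))\<^sup>2) integrable_on {0..1}"
    by (intro integrable_continuous_real continuous_intros cont)
  have "integral {0..1} (\<lambda>t. norm (f t)) \<le> integral {0..1} (\<lambda>t. (norm (f t))\<^sup>2 * (1 / (2 * s)) + s / 2)"
  proof (rule integral_le)
    fix t
    have "0 \<le> (norm (f t) - s)\<^sup>2" by simp
    then have "2 * s * norm (f t) \<le> (norm (f t))\<^sup>2 + s\<^sup>2" by (simp add: power2_eq_square algebra_simps)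
    then show "norm (f t) \<le> (norm (f t))\<^sup>2 * (1 / (2 * s)) + s / 2"
      using s by (simp add: field_simps power2_eq_square)
  qed (use cont s in \<open>auto intro!: integrable_continuous_real continuous_intros\<close>)
  also have "\<dots> = integral {0..1} (\<lambda>t. (norm (f t))\<^sup>2) * (1 / (2 * s)) + s / 2"
    by (subst Henstock_Kurzweil_Integration.integral_add)
      (use int s in \<open>auto intro!: integrable_continuous_real continuous_intros cont\<close>)
  also have "\<dots> \<le> s\<^sup>2 * (1 / (2 * s)) + s / 2"
    using s by (intro add_right_mono mult_right_mono sq) auto
  also have "\<dots> = s" using s by (simp add: power2_eq_square)
  finally show ?thesis .
qed

text \<open>Taylor polynomials have radial limits everywhere, so the oscillation of \<open>h\<close> along a radius is
  controlled by the radial maximal function of a Taylor remainder.\<close>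

lemma Fatou_oscillation_negligible:
  fixes h :: "complex \<Rightarrow> complex"
  assumes h: "h holomorphic_on ball 0 1" and M: "\<And>z. z \<in> ball 0 1 \<Longrightarrow> norm (h z) \<le> M" and e: "0 < e"
  shows "negligible {t \<in> {0..1}. \<not> (\<exists>b<1. \<forall>r\<in>{b<..<1}. \<forall>q\<in>{b<..<1}.
      dist (h (of_real r * circ t)) (h (of_real q * circ t)) \<le> e)}" (is "negligible ?N")
  unfolding negligible_outer_le
proof (intro allI impI)
  fix \<eta> :: real assume \<eta>: "0 < \<eta>"
  \<comment> \<open>With this choice the threshold \<open>2 * pi * c\<close> of the maximal
    inequality is \<open>e / 3\<close>; \<open>s\<close> is then chosen so that its bound
    \<open>20 / c * s\<close> equals \<open>\<eta>\<close>.\<close>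
  define c where "c = e / (6 * pi)"
  have c: "0 < c" and c3: "2 * pi * c = e / 3" using e by (auto simp: c_def)
  define s where "s = \<eta> * c / 20"
  have s: "0 < s" using \<eta> c by (simp add: s_def)
  have s2: "0 < s\<^sup>2" using s by simp
  obtain a N where aN: "\<forall>R\<in>{0<..<1}. integral {0..1} (\<lambda>t. (norm (h (of_real R * circ t) - (\<Sum>n<N. a n * (of_real R * circ t) ^ n)))\<^sup>2) \<le> s\<^sup>2"
    using Taylor_tail_square_mean[OF h M s2] by blast
  define P where "P z = (\<Sum>n<N. a n * z ^ n)" for z
  define k where "k z = h z - P z" for z
  have holk: "k holomorphic_on ball 0 1"
    unfolding k_def[abs_def] P_def by (intro holomorphic_intros h)
  \<comment> \<open>The maximal inequality demands holomorphy beyond the closed disc, so it is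
    applied to the dilates of \<open>k\<close>. The sets \<open>E R\<close> increase with
    \<open>R\<close> and all have measure at most \<open>\<eta>\<close>; hence so does their union
    along a sequence of radii.\<close>
  define E where "E R = {t \<in> {0..1}. \<exists>r\<in>{0<..<1}. 2 * pi * c < norm (k (of_real R * (of_real r * circ t)))}" for R :: real
  have E: "E R \<in> lmeasurable" "measure lebesgue (E R) \<le> \<eta>" if R: "0 < R" "R < 1" for R
  proof -
    have img: "(\<lambda>z. complex_of_real R * z) ` ball 0 (1 / R) \<subseteq> ball 0 1"
      using R by (auto simp: norm_mult field_simps)
    have kR: "(\<lambda>z. k (of_real R * z)) holomorphic_on ball 0 (1 / R)"
      using holomorphic_on_compose[OF _ holomorphic_on_subset[OF holk img]]
      by (simp add: o_def holomorphic_intros)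
    have R1: "1 < 1 / R" using R by simp
    show "E R \<in> lmeasurable" unfolding E_def by (rule radial_maximal_weak_type(1)[OF kR R1 c])
    have "continuous_on {0..1} (\<lambda>t. k (of_real R * circ t))"
    proof -
      have "(\<lambda>t. of_real R * circ t) ` {0..1} \<subseteq> ball 0 1" using R by (auto simp: norm_mult)
      moreover have "continuous_on {0..1} (\<lambda>t. of_real R * circ t)" by (intro continuous_intros)
      ultimately show ?thesis
        using continuous_on_compose continuous_on_subset[OF holomorphic_on_imp_continuous_on[OF holk]]
        unfolding o_def by blast
    qed
    then have "integral {0..1} (\<lambda>t. norm (k (of_real R * circ t))) \<le> s"
      using aN R s by (intro integral_norm_le_of_square) (simp_all add: k_def P_def)
    then have "20 / c * integral {0..1} (\<lambda>t. norm (k (of_real R * circ t))) \<le> 20 / c * s"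
      using c by (intro mult_left_mono) auto
    also have "\<dots> = \<eta>" using c by (simp add: s_def)
    finally show "measure lebesgue (E R) \<le> \<eta>"
      using radial_maximal_weak_type(2)[OF kR R1 c] by (simp add: E_def)
  qed
  have mono: "E R \<subseteq> E R'" if "0 < R" "R \<le> R'" for R R'
  proof
    fix t assume "t \<in> E R"
    then obtain r where r: "t \<in> {0..1}" "0 < r" "r < 1" "2 * pi * c < norm (k (of_real R * (of_real r * circ t)))"
      by (auto simp: E_def)
    have eq: "of_real R * (of_real r * circ t) = of_real R' * (of_real (R * r / R') * circ t)"
      using that by simp
    have "R * r / R' \<in> {0<..<1}"
    proof -
      have "R * r < R * 1" using that r by (intro mult_strict_left_mono) auto
      then have "R * r < R'" using that by linarith
      then show ?thesis using that r by simp
    qed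
    then have "\<exists>r\<in>{0<..<1}. 2 * pi * c < norm (k (of_real R' * (of_real r * circ t)))"
      using r(4) unfolding eq by (intro bexI)
    then show "t \<in> E R'" using r(1) unfolding E_def by blast
  qed
  define u where "u i = 1 - 1 / (real i + 2)" for i :: nat
  have u: "0 < u i" "u i < 1" "i \<le> j \<Longrightarrow> u i \<le> u j" for i j
    by (auto simp: u_def frac_le)
  have UN: "(\<Union>i\<le>n. E (u i)) = E (u n)" for n
    using mono[OF u(1) u(3)] by blast
  show "\<exists>T. ?N \<subseteq> T \<and> T \<in> lmeasurable \<and> measure lebesgue T \<le> \<eta>"
  proof (intro exI conjI)
    show "(\<Union>i. E (u i)) \<in> lmeasurable"
      by (rule fmeasurable_countable_Union[where B = \<eta>]) (use E u UN in auto)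
    show "measure lebesgue (\<Union>i. E (u i)) \<le> \<eta>"
      by (rule measure_countable_Union_le) (use E u UN in auto)
    show "?N \<subseteq> (\<Union>i. E (u i))"
    proof
      fix t assume t: "t \<in> ?N"
      have "((\<lambda>r. P (of_real r * circ t)) \<longlongrightarrow> P (of_real 1 * circ t)) (at_left 1)"
        unfolding P_def by (intro tendsto_intros)
      moreover have "0 < e / 6" using e by simp
      ultimately have "\<forall>\<^sub>F r in at_left 1. dist (P (of_real r * circ t)) (P (of_real 1 * circ t)) < e / 6"
        by (rule tendstoD)
      then obtain b where b: "b < 1"
        "\<And>r. b < r \<Longrightarrow> r < 1 \<Longrightarrow> dist (P (of_real r * circ t)) (P (of_real 1 * circ t)) < e / 6"
        unfolding eventually_at_left_field by blast
      have "max b 0 < 1" using b by simp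
      then have "\<not> (\<forall>r\<in>{max b 0<..<1}. \<forall>q\<in>{max b 0<..<1}.
          dist (h (of_real r * circ t)) (h (of_real q * circ t)) \<le> e)"
        using t by blast
      then obtain r q where rq: "max b 0 < r" "r < 1" "max b 0 < q" "q < 1"
        "e < dist (h (of_real r * circ t)) (h (of_real q * circ t))"
        by (meson not_le greaterThanLessThan_iff)
      have "dist (P (of_real r * circ t)) (P (of_real q * circ t)) \<le> e / 6 + e / 6"
        using b(2)[of r] b(2)[of q] rq
          dist_triangle2[of "P (of_real r * circ t)" "P (of_real q * circ t)" "P (of_real 1 * circ t)"] by simp
      moreover have "dist (h (of_real r * circ t)) (h (of_real q * circ t))
          \<le> norm (k (of_real r * circ t)) + dist (P (of_real r * circ t)) (P (of_real q * circ t)) + norm (k (of_real q * circ t))"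
      proof -
        have "h (of_real r * circ t) - h (of_real q * circ t) = k (of_real r * circ t)
            + (P (of_real r * circ t) - P (of_real q * circ t)) - k (of_real q * circ t)"
          by (simp add: k_def)
        then show ?thesis
          unfolding dist_norm by (metis norm_triangle_ineq norm_triangle_ineq4 add_right_mono order_trans)
      qed
      \<comment> \<open>The polynomial part accounts for at most \<open>e / 3\<close> of an
        oscillation larger than \<open>e\<close>, so the two remainders share more than
        \<open>2 * e / 3\<close>.\<close>
      ultimately have "e / 3 < norm (k (of_real r * circ t)) \<or> e / 3 < norm (k (of_real q * circ t))"
        using rq(5) by linarith
      then obtain x where x: "0 < x" "x < 1" "e / 3 < norm (k (of_real x * circ t))"
        using rq by auto
      obtain i :: nat where "1 / (real i + 1) < 1 - x"
        using reals_Archimedean[of "1 - x"] x(2) by (auto simp: inverse_eq_divide add.commute)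
      then have xi: "x < u i" 
      proof -
        have "1 / (real i + 2) \<le> 1 / (real i + 1)" by (intro divide_left_mono) auto
        then show ?thesis using \<open>1 / (real i + 1) < 1 - x\<close> by (simp add: u_def)
      qed
      have "of_real (u i) * (of_real (x / u i) * circ t) = of_real x * circ t"
        using u(1)[of i] by simp
      moreover have "x / u i \<in> {0<..<1}" using x xi u(1)[of i] by simp
      ultimately have "\<exists>r\<in>{0<..<1}. 2 * pi * c < norm (k (of_real (u i) * (of_real r * circ t)))"
        using x(3) by (intro bexI[of _ "x / u i"]) (simp_all only: c3)
      then have "t \<in> E (u i)" using t unfolding E_def by blast
      then show "t \<in> (\<Union>i. E (u i))" by blast
    qed
  qed
qed

text \<open>Where the limit fails to exist, the Cauchy criterion fails at one of the tolerances
  \<open>1 / (real m + 1)\<close>, so the exceptional set is covered by countably many negligible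
  sets.\<close>

theorem Fatou_bounded_holomorphic:
  fixes h :: "complex \<Rightarrow> complex"
  assumes h: "h holomorphic_on ball 0 1" and M: "\<And>z. z \<in> ball 0 1 \<Longrightarrow> norm (h z) \<le> M"
  shows "negligible {t \<in> {0..1}. \<not> (\<exists>L. ((\<lambda>r. h (of_real r * circ t)) \<longlongrightarrow> L) (at_left 1))}"
proof -
  define N where "N m = {t \<in> {0..1}. \<not> (\<exists>b<1. \<forall>r\<in>{b<..<1}. \<forall>q\<in>{b<..<1}.
      dist (h (of_real r * circ t)) (h (of_real q * circ t)) \<le> 1 / (real m + 1))}" for m :: nat
  have "negligible (N m)" for m
    unfolding N_def by (rule Fatou_oscillation_negligible[OF h M]) auto
  then have "negligible (\<Union>m. N m)" by (intro negligible_countable_Union) auto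
  moreover have "{t \<in> {0..1}. \<not> (\<exists>L. ((\<lambda>r. h (of_real r * circ t)) \<longlongrightarrow> L) (at_left 1))} \<subseteq> (\<Union>m. N m)"
  proof safe
    fix t :: real
    assume t: "t \<in> {0..1}" "\<not> (\<exists>L. ((\<lambda>r. h (of_real r * circ t)) \<longlongrightarrow> L) (at_left 1))"
    show "t \<in> (\<Union>m. N m)"
    proof (rule ccontr)
      assume "t \<notin> (\<Union>m. N m)"
      then have *: "\<exists>b<1. \<forall>r\<in>{b<..<1}. \<forall>q\<in>{b<..<1}.
          dist (h (of_real r * circ t)) (h (of_real q * circ t)) \<le> 1 / (real m + 1)" for m
        using t(1) by (auto simp: N_def)
      have "\<exists>L. ((\<lambda>r. h (of_real r * circ t)) \<longlongrightarrow> L) (at_left 1)"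
        unfolding tendsto_at_left_1_iff_Cauchy
      proof
        fix m :: nat
        obtain b where b: "b < 1" "\<forall>r\<in>{b<..<1}. \<forall>q\<in>{b<..<1}.
          dist (h (of_real r * circ t)) (h (of_real q * circ t)) \<le> 1 / (real m + 1)" using * by blast
        obtain j :: nat where "1 / (real j + 1) < 1 - b"
          using reals_Archimedean[of "1 - b"] b(1) by (auto simp: inverse_eq_divide add.commute)
        then have "{1 - 1 / (real j + 1)<..<1} \<subseteq> {b<..<1}" by auto
        then show "\<exists>j::nat. \<forall>r\<in>{1 - 1 / (real j + 1)<..<1}. \<forall>q\<in>{1 - 1 / (real j + 1)<..<1}.
            dist (h (of_real r * circ t)) (h (of_real q * circ t)) \<le> 1 / (real m + 1)"
          using b(2) by blast
      qed
      then show False using t(2) by blast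
    qed
  qed
  ultimately show ?thesis by (rule negligible_subset)
qed

subsection \<open>The surface measure and radial limits on the sphere\<close>

lemma space_surface_measure [simp]: "space surface_measure = sphere 0 1"
  by (simp add: surface_measure_def space_restrict_space space_scale_measure)

lemma sets_surface_measure [measurable_cong]: "sets surface_measure = sets (restrict_space borel (sphere 0 1))"
  by (simp add: surface_measure_def)

lemma measurable_normalize:
  "(\<lambda>x::'a::euclidean_space. x /\<^sub>R norm x) \<in> measurable (restrict_space lborel (ball 0 1 - {0})) (restrict_space borel (sphere 0 1))"
  by (rule measurable_restrict_space3) auto

text \<open>This cone formula is the gateway to the surface measure: null sets, rotation averages
  and the size of nonisotropic balls are all computed from Lebesgue integrals of functions constant
  on rays.\<close>

lemma nn_integral_surface_measure:
  fixes F :: "'a::euclidean_space \<Rightarrow> ennreal"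
  assumes F: "F \<in> borel_measurable surface_measure"
  shows "(\<integral>\<^sup>+\<zeta>. F \<zeta> \<partial>surface_measure)
    = of_nat DIM('a) * (\<integral>\<^sup>+x. F (x /\<^sub>R norm x) * indicator (ball 0 1 - {0}) x \<partial>lborel)"
proof -
  have F': "F \<in> borel_measurable (restrict_space borel (sphere 0 1))"
    using F by (simp add: measurable_cong_sets[OF sets_surface_measure refl])
  let ?D = "distr (restrict_space lborel (ball 0 1 - {0})) (restrict_space borel (sphere 0 1)) (\<lambda>x::'a. x /\<^sub>R norm x)"
  have "(\<integral>\<^sup>+\<zeta>. F \<zeta> \<partial>surface_measure) = of_nat DIM('a) * (\<integral>\<^sup>+\<zeta>. F \<zeta> \<partial>?D)"
    unfolding surface_measure_def by (rule nn_integral_scale_measure) (use F' in simp)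
  also have "(\<integral>\<^sup>+\<zeta>. F \<zeta> \<partial>?D) = (\<integral>\<^sup>+x. F (x /\<^sub>R norm x) \<partial>restrict_space lborel (ball 0 1 - {0}))"
    by (rule nn_integral_distr[OF measurable_normalize]) (use F' in simp)
  also have "\<dots> = (\<integral>\<^sup>+x. F (x /\<^sub>R norm x) * indicator (ball 0 1 - {0}) x \<partial>lborel)"
    by (rule nn_integral_restrict_space) simp
  finally show ?thesis .
qed

lemma emeasure_surface_measure:
  fixes A :: "'a::euclidean_space set"
  assumes "A \<in> sets surface_measure"
  shows "emeasure surface_measure A
    = of_nat DIM('a) * (\<integral>\<^sup>+x. indicator A (x /\<^sub>R norm x) * indicator (ball 0 1 - {0}) x \<partial>lborel)"
  using nn_integral_surface_measure[of "indicator A"] assms by simp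

lemma finite_surface_measure: "finite_measure (surface_measure :: 'a::euclidean_space measure)"
proof (rule finite_measureI)
  have "emeasure surface_measure (sphere (0::'a) 1)
     \<le> of_nat DIM('a) * (\<integral>\<^sup>+x. indicator (ball (0::'a) 1) x \<partial>lborel)"
  proof (subst emeasure_surface_measure)
    show "sphere (0::'a) 1 \<in> sets surface_measure"
      by (simp add: sets_surface_measure sets_restrict_space_iff)
  qed (intro mult_left_mono nn_integral_mono; auto split: split_indicator)
  also have "\<dots> < \<infinity>"
    using emeasure_lborel_ball_finite[of "0::'a" 1]
    by (auto simp: ennreal_mult_less_top of_nat_less_top)
  finally show "emeasure surface_measure (space (surface_measure :: 'a measure)) \<noteq> \<infinity>" by simp
qed

interpretation surface_measure: finite_measure "surface_measure :: 'a::euclidean_space measure"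
  by (rule finite_surface_measure)

lemma borel_measurable_surface_measure_continuous:
  fixes f :: "'a::euclidean_space \<Rightarrow> 'b::topological_space"
  assumes "continuous_on (sphere 0 1) f"
  shows "f \<in> borel_measurable surface_measure"
  using borel_measurable_continuous_on_restrict[OF assms]
  by (simp add: measurable_cong_sets[OF sets_surface_measure refl])

section \<open>Complex scalars, slices by complex lines and rotation averages\<close>

lemma norm_vector_smult: "norm (c *s x) = norm c * norm x" for x :: "complex ^ 'n"
  by (simp add: norm_vec_def norm_mult L2_set_right_distrib)

lemma linear_vector_smult: "linear (\<lambda>x :: complex ^ 'n. c *s x)"
  by (rule linearI) (simp_all add: vec_eq_iff algebra_simps)

lemma linear_smult_vector: "linear (\<lambda>c. c *s (x :: complex ^ 'n))"
  by (rule linearI) (simp_all add: vec_eq_iff algebra_simps)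

lemma scaleR_vec_eq_smult: "r *\<^sub>R x = complex_of_real r *s x" for x :: "complex ^ 'n"
  by (simp add: vec_eq_iff) (simp add: scaleR_conv_of_real)

lemma continuous_on_vector_smult [continuous_intros]:
  fixes g :: "'a::topological_space \<Rightarrow> complex ^ 'n"
  assumes "continuous_on S f" "continuous_on S g"
  shows "continuous_on S (\<lambda>x. f x *s g x)"
proof -
  have "continuous_on S (\<lambda>x. \<chi> i. f x * g x $ i)"
    by (intro continuous_on_vec_lambda continuous_intros assms)
  then show ?thesis by (simp add: vector_scalar_mult_def)
qed

lemma holomorphic_vec_on_imp_continuous_on:
  assumes "holomorphic_vec_on f U"
  shows "continuous_on U f"
proof -
  have "isCont f z" if "z \<in> U" for z
    using assms that unfolding holomorphic_vec_on_def by (meson has_derivative_continuous)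
  then show ?thesis by (simp add: continuous_at_imp_continuous_on)
qed

text \<open>Complex linearity of the derivative \<open>D\<close> makes the derivative along the line
  multiplication by the number \<open>D v\<close>.\<close>

lemma holomorphic_on_slice:
  fixes f :: "complex ^ 'n \<Rightarrow> complex"
  assumes "holomorphic_vec_on f U" and "\<And>c. c \<in> S \<Longrightarrow> w + c *s v \<in> U"
  shows "(\<lambda>c. f (w + c *s v)) holomorphic_on S"
proof (rule holomorphic_onI)
  fix c assume "c \<in> S"
  then obtain D where D: "(f has_derivative D) (at (w + c *s v))" "\<And>c v. D (c *s v) = c * D v"
    using assms unfolding holomorphic_vec_on_def by blast
  have "((\<lambda>c. w + c *s v) has_derivative (\<lambda>c. 0 + c *s v)) (at c within S)"
    by (intro has_derivative_add has_derivative_const linear_imp_has_derivative linear_smult_vector)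
  from has_derivative_compose[OF this D(1)]
  have "((\<lambda>c. f (w + c *s v)) has_derivative (\<lambda>c. D v * c)) (at c within S)"
    by (simp add: D(2) mult.commute)
  then show "(\<lambda>c. f (w + c *s v)) field_differentiable (at c within S)"
    unfolding field_differentiable_def has_field_derivative_def by (intro exI)
qed

lemma nn_integral_rotation:
  fixes F :: "complex ^ 'n \<Rightarrow> ennreal"
  assumes "F \<in> borel_measurable borel"
  shows "(\<integral>\<^sup>+x. F (circ t *s x) \<partial>lborel) = (\<integral>\<^sup>+x. F x \<partial>lborel)"
  by (rule nn_integral_lborel_isometry[OF linear_vector_smult _ assms]) (simp add: norm_vector_smult)

lemma ball_minus_0_borel: "ball 0 1 - {0 :: 'a::euclidean_space} \<in> sets borel"
  by (intro sets.Diff borel_open borel_closed) auto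

lemma borel_measurable_rotations:
  fixes F :: "complex ^ 'n \<Rightarrow> ennreal"
  assumes F[measurable]: "F \<in> borel_measurable borel"
  shows "(\<lambda>(x, t). F (circ t *s x) * indicator {0..1} t) \<in> borel_measurable (lborel \<Otimes>\<^sub>M lborel)"
proof -
  have "continuous_on UNIV (\<lambda>p. circ (snd p) *s (fst p :: complex ^ 'n))"
    by (intro continuous_intros)
  then have [measurable]: "(\<lambda>p. circ (snd p) *s (fst p :: complex ^ 'n)) \<in> borel_measurable (borel \<Otimes>\<^sub>M borel)"
    by (simp add: borel_prod borel_measurable_continuous_onI)
  have "(\<lambda>p. F (circ (snd p) *s fst p)) \<in> borel_measurable (borel \<Otimes>\<^sub>M borel)"
    by measurable
  then show ?thesis by (simp add: case_prod_beta)
qed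

text \<open>Each rotation preserves the integral, hence so does their mean. Replacing an integrand
  by its means over the circles \<open>circ t *s x\<close> is what allows one-variable theorems to
  be applied.\<close>

lemma nn_integral_rotation_average:
  fixes F :: "complex ^ 'n \<Rightarrow> ennreal"
  assumes F[measurable]: "F \<in> borel_measurable borel"
  shows "(\<integral>\<^sup>+x. (\<integral>\<^sup>+t. F (circ t *s x) * indicator {0..1} t \<partial>lborel) \<partial>lborel) = (\<integral>\<^sup>+x. F x \<partial>lborel)"
proof -
  note m' = borel_measurable_rotations[OF F]
  have "(\<integral>\<^sup>+x. (\<integral>\<^sup>+t. F (circ t *s x) * indicator {0..1} t \<partial>lborel) \<partial>lborel)
      = (\<integral>\<^sup>+t. (\<integral>\<^sup>+x. F (circ t *s x) * indicator {0..1} t \<partial>lborel) \<partial>lborel)"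
    by (rule lborel_pair.Fubini'[OF m', symmetric])
  also have "\<dots> = (\<integral>\<^sup>+t. (\<integral>\<^sup>+x. F x \<partial>lborel) * indicator {0..1::real} t \<partial>lborel)"
  proof (rule nn_integral_cong)
    fix t :: real
    have "continuous_on UNIV (\<lambda>x. circ t *s (x :: complex ^ 'n))" by (intro continuous_intros)
    then have [measurable]: "(\<lambda>x. circ t *s (x :: complex ^ 'n)) \<in> borel_measurable borel"
      by (rule borel_measurable_continuous_onI)
    show "(\<integral>\<^sup>+x. F (circ t *s x) * indicator {0..1} t \<partial>lborel) = (\<integral>\<^sup>+x. F x \<partial>lborel) * indicator {0..1} t"
      by (subst nn_integral_multc) (simp_all add: nn_integral_rotation)
  qed
  also have "\<dots> = (\<integral>\<^sup>+x. F x \<partial>lborel)"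
    by (subst nn_integral_cmult) simp_all
  finally show ?thesis .
qed

section \<open>Measurability of radial limits\<close>

lemma sets_surface_measureI:
  "A \<in> sets borel \<Longrightarrow> A \<subseteq> sphere 0 1 \<Longrightarrow> A \<in> sets surface_measure"
  by (simp add: sets_surface_measure sets_restrict_space_iff)

text \<open>Only the quantifiers over \<open>m\<close> and \<open>j\<close> have to be countable;
  the uncountable intersections over the radii are taken of closed sets and stay closed.\<close>

lemma sets_radial_limit:
  fixes f :: "'a::euclidean_space \<Rightarrow> complex"
  assumes f: "continuous_on (ball 0 1) f"
  shows "{\<zeta> \<in> sphere 0 1. \<exists>L. ((\<lambda>r. f (r *\<^sub>R \<zeta>)) \<longlongrightarrow> L) (at_left 1)} \<in> sets borel"
proof -
  define I where "I j = {1 - 1 / (real j + 1)<..<1}" for j :: nat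
  have I: "0 < r \<and> r < 1" if "r \<in> I j" for r j
  proof -
    have "0 \<le> 1 - 1 / (real j + 1)" by simp
    then show ?thesis using that unfolding I_def by (meson greaterThanLessThan_iff le_less_trans)
  qed
  have cont: "continuous_on (sphere 0 1) (\<lambda>\<zeta>. f (r *\<^sub>R \<zeta>))" if "0 < r" "r < 1" for r
    by (rule continuous_on_compose2[OF f]) (use that in \<open>auto intro!: continuous_intros\<close>)
  have cl: "closed {\<zeta> \<in> sphere 0 1. dist (f (r *\<^sub>R \<zeta>)) (f (q *\<^sub>R \<zeta>)) \<le> e}"
    if "r \<in> I j" "q \<in> I j" for r q e j
  proof -
    have "closed (sphere 0 1 \<inter> (\<lambda>\<zeta>. dist (f (r *\<^sub>R \<zeta>)) (f (q *\<^sub>R \<zeta>))) -` {..e})"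
      using I[OF that(1)] I[OF that(2)]
      by (intro continuous_closed_preimage continuous_on_dist cont) auto
    then show ?thesis by (simp add: Int_def vimage_def)
  qed
  have "{\<zeta> \<in> sphere 0 1. \<exists>L. ((\<lambda>r. f (r *\<^sub>R \<zeta>)) \<longlongrightarrow> L) (at_left 1)} =
      (\<Inter>m::nat. \<Union>j::nat. \<Inter>r\<in>I j. \<Inter>q\<in>I j.
        {\<zeta> \<in> sphere 0 1. dist (f (r *\<^sub>R \<zeta>)) (f (q *\<^sub>R \<zeta>)) \<le> 1 / (real m + 1)})"
  proof -
    have iff: "(\<exists>L. ((\<lambda>r. f (r *\<^sub>R \<zeta>)) \<longlongrightarrow> L) (at_left 1)) \<longleftrightarrow>
        (\<forall>m::nat. \<exists>j. \<forall>r\<in>I j. \<forall>q\<in>I j. dist (f (r *\<^sub>R \<zeta>)) (f (q *\<^sub>R \<zeta>)) \<le> 1 / (real m + 1))" for \<zeta>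
      unfolding I_def by (rule tendsto_at_left_1_iff_Cauchy)
    \<comment> \<open>An intersection over an empty interval would be the whole space, and the
      restriction to the sphere would be lost.\<close>
    have ne: "\<exists>r. r \<in> I j" for j
    proof -
      have "1 - 1 / (real j + 1) < 1" by simp
      from dense[OF this] show ?thesis by (auto simp: I_def)
    qed
    show ?thesis
    proof (rule set_eqI)
      fix \<zeta> :: 'a
      show "\<zeta> \<in> {\<zeta> \<in> sphere 0 1. \<exists>L. ((\<lambda>r. f (r *\<^sub>R \<zeta>)) \<longlongrightarrow> L) (at_left 1)} \<longleftrightarrow>
        \<zeta> \<in> (\<Inter>m::nat. \<Union>j::nat. \<Inter>r\<in>I j. \<Inter>q\<in>I j.
        {\<zeta> \<in> sphere 0 1. dist (f (r *\<^sub>R \<zeta>)) (f (q *\<^sub>R \<zeta>)) \<le> 1 / (real m + 1)})"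
        unfolding mem_Collect_eq INT_iff UN_iff iff ball_UNIV bex_UNIV
        using ne by (cases "\<zeta> \<in> sphere 0 1") (simp_all only: simp_thms ball_simps, blast)
    qed
  qed
  moreover have "(\<Union>j::nat. \<Inter>r\<in>I j. \<Inter>q\<in>I j.
        {\<zeta> \<in> sphere 0 1. dist (f (r *\<^sub>R \<zeta>)) (f (q *\<^sub>R \<zeta>)) \<le> 1 / (real m + 1)}) \<in> sets borel" for m :: nat
    using cl by (intro sets.countable_UN image_subsetI borel_closed closed_INT ballI)
  ultimately show ?thesis by (simp add: sets.countable_INT image_subset_iff)
qed

text \<open>On the set of convergence the boundary value is a limit along one sequence of radii. Off
  this set \<open>Lim\<close> is a description of an unsatisfiable property, hence the single value
  \<open>THE l. False\<close>, so the two pieces glue to a measurable function.\<close>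

lemma borel_measurable_boundary_value:
  fixes f :: "complex ^ 'n \<Rightarrow> complex"
  assumes f: "continuous_on (ball 0 1) f"
  shows "boundary_value f \<in> borel_measurable surface_measure"
proof -
  define A where "A = {\<zeta> \<in> sphere 0 1. \<exists>L. ((\<lambda>r. f (r *\<^sub>R \<zeta>)) \<longlongrightarrow> L) (at_left 1)}"
  define u where "u i = 1 - 1 / (real i + 2)" for i :: nat
  have u: "0 < u i" "u i < 1" for i by (auto simp: u_def)
  have "u \<longlonglongrightarrow> 1" unfolding u_def by real_asymp
  then have ulim: "filterlim u (at_left 1) sequentially"
    using u(2) less_imp_neq[OF u(2)] by (auto simp: filterlim_at intro!: always_eventually)
  have A: "A \<in> sets surface_measure"
    by (rule sets_surface_measureI, unfold A_def, rule sets_radial_limit[OF f]) blast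
  have m: "(\<lambda>\<zeta>. f (u i *\<^sub>R \<zeta>)) \<in> borel_measurable surface_measure" for i
  proof (rule borel_measurable_surface_measure_continuous, rule continuous_on_compose2[OF f])
    show "(\<lambda>\<zeta>::complex ^ 'n. u i *\<^sub>R \<zeta>) ` sphere 0 1 \<subseteq> ball 0 1"
      using u[of i] by (simp add: image_subset_iff)
  qed (intro continuous_intros)
  have meas: "(\<lambda>\<zeta>. if \<zeta> \<in> A then lim (\<lambda>i. f (u i *\<^sub>R \<zeta>)) else (THE l. False)) \<in> borel_measurable surface_measure"
  proof (intro measurable_If_set borel_measurable_lim_metric m)
    show "A \<inter> space surface_measure \<in> sets surface_measure"
      using A by (rule sets.Int) (rule sets.top)
  qed auto
  have eq: "(if \<zeta> \<in> A then lim (\<lambda>i. f (u i *\<^sub>R \<zeta>)) else (THE l. False)) = boundary_value f \<zeta>"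
    if "\<zeta> \<in> space surface_measure" for \<zeta>
  proof (cases "\<zeta> \<in> A")
    case True
    then obtain L where L: "((\<lambda>r. f (r *\<^sub>R \<zeta>)) \<longlongrightarrow> L) (at_left 1)" by (auto simp: A_def)
    have "(\<lambda>i. f (u i *\<^sub>R \<zeta>)) \<longlonglongrightarrow> L" by (rule filterlim_compose[OF L ulim])
    then have "lim (\<lambda>i. f (u i *\<^sub>R \<zeta>)) = L" by (rule limI)
    moreover have "boundary_value f \<zeta> = L"
      unfolding boundary_value_def by (rule tendsto_Lim[OF trivial_limit_at_left_real L])
    ultimately show ?thesis using True by simp
  next
    case False
    then have "\<not> ((\<lambda>r. f (r *\<^sub>R \<zeta>)) \<longlongrightarrow> L) (at_left 1)" for L
      using that by (auto simp: A_def)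
    then show ?thesis using False by (simp add: boundary_value_def Topological_Spaces.Lim_def)
  qed
  show ?thesis
    by (rule measurable_cong[THEN iffD1, OF eq meas])
qed

text \<open>By rotation invariance a subset of the sphere is a null set once almost every point of each
  circle \<open>{circ t *s \<zeta>}\<close> avoids it.\<close>

theorem AE_radial_limit_bounded_holomorphic:
  fixes g :: "complex ^ 'n \<Rightarrow> complex"
  assumes g: "holomorphic_vec_on g (ball 0 1)" and bd: "bounded (g ` ball 0 1)"
  shows "AE \<zeta> in surface_measure. \<exists>L. ((\<lambda>r. g (r *\<^sub>R \<zeta>)) \<longlongrightarrow> L) (at_left 1)"
proof -
  define A where "A = {\<zeta> \<in> sphere 0 1. \<exists>L. ((\<lambda>r. g (r *\<^sub>R \<zeta>)) \<longlongrightarrow> L) (at_left 1)}"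
  define N where "N = sphere 0 1 - A"
  obtain M where M: "\<And>x. x \<in> ball 0 1 \<Longrightarrow> norm (g x) \<le> M"
    using bd unfolding bounded_iff by blast
  have "A \<in> sets borel"
    unfolding A_def by (rule sets_radial_limit[OF holomorphic_vec_on_imp_continuous_on[OF g]])
  then have N: "N \<in> sets borel" unfolding N_def by (intro sets.Diff[OF borel_closed[OF closed_sphere]])
  then have Ns: "N \<in> sets surface_measure" by (rule sets_surface_measureI) (auto simp: N_def)
  define F :: "complex ^ 'n \<Rightarrow> ennreal"
    where "F x = indicator N (x /\<^sub>R norm x) * indicator (ball 0 1 - {0}) x" for x
  have [measurable]: "F \<in> borel_measurable borel"
  proof -
    note N[measurable] ball_minus_0_borel[measurable]
    show ?thesis unfolding F_def by measurable
  qed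
  have slice: "(\<integral>\<^sup>+t. F (circ t *s x) * indicator {0..1} t \<partial>lborel) = 0" for x
  proof (cases "x = 0 \<or> 1 \<le> norm x")
    case True
    then show ?thesis by (auto simp: F_def norm_vector_smult)
  next
    case False
    define \<zeta> where "\<zeta> = x /\<^sub>R norm x"
    have \<zeta>: "norm \<zeta> = 1" using False by (simp add: \<zeta>_def)
    \<comment> \<open>As \<open>\<zeta>\<close> is a unit vector, \<open>h\<close> is bounded and
      holomorphic on the whole unit disc, and the radius of the disc towards \<open>circ t\<close>
      becomes the radius of the ball towards \<open>circ t *s \<zeta>\<close>.\<close>
    define h where "h c = g (0 + c *s \<zeta>)" for c
    have "h holomorphic_on ball 0 1"
      unfolding h_def by (rule holomorphic_on_slice[OF g]) (simp add: norm_vector_smult \<zeta>)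
    moreover have "norm (h c) \<le> M" if "c \<in> ball 0 1" for c
      unfolding h_def using that by (intro M) (simp add: norm_vector_smult \<zeta>)
    ultimately have neg: "negligible {t \<in> {0..1}. \<not> (\<exists>L. ((\<lambda>r. h (of_real r * circ t)) \<longlongrightarrow> L) (at_left 1))}"
      by (rule Fatou_bounded_holomorphic)
    have heq: "h (of_real r * circ t) = g (r *\<^sub>R (circ t *s \<zeta>))" for r t
      unfolding h_def scaleR_vec_eq_smult by (simp add: vector_smult_assoc)
    have "AE t in lebesgue. t \<notin> {t \<in> {0..1}. \<not> (\<exists>L. ((\<lambda>r. h (of_real r * circ t)) \<longlongrightarrow> L) (at_left 1))}"
      using neg unfolding negligible_iff_null_sets by (rule AE_not_in)
    then have "AE t in lborel. t \<notin> {t \<in> {0..1}. \<not> (\<exists>L. ((\<lambda>r. h (of_real r * circ t)) \<longlongrightarrow> L) (at_left 1))}"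
      by (simp only: AE_completion_iff)
    then have "AE t in lborel. F (circ t *s x) * indicator {0..1} t = 0"
    proof eventually_elim
      case (elim t)
      have eq: "(circ t *s x) /\<^sub>R norm (circ t *s x) = circ t *s \<zeta>"
        unfolding \<zeta>_def norm_vector_smult by (simp add: vec_eq_iff)
      show ?case
      proof (cases "t \<in> {0..1}")
        case True
        with elim have "\<exists>L. ((\<lambda>r. h (of_real r * circ t)) \<longlongrightarrow> L) (at_left 1)" by blast
        then have "circ t *s \<zeta> \<in> A" unfolding A_def heq using \<zeta> by (simp add: norm_vector_smult)
        then have "circ t *s \<zeta> \<notin> N" by (simp add: N_def)
        then show ?thesis unfolding F_def eq by simp
      qed simp
    qed
    then have "(\<integral>\<^sup>+t. F (circ t *s x) * indicator {0..1} t \<partial>lborel) = (\<integral>\<^sup>+t. 0 \<partial>(lborel :: real measure))"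
      by (rule nn_integral_cong_AE)
    then show ?thesis by simp
  qed
  have "emeasure surface_measure N = of_nat DIM(complex ^ 'n) * (\<integral>\<^sup>+x. F x \<partial>lborel)"
    unfolding F_def by (rule emeasure_surface_measure[OF Ns])
  also have "(\<integral>\<^sup>+x. F x \<partial>lborel) = 0"
    using nn_integral_rotation_average[of F] slice by simp
  finally have "N \<in> null_sets surface_measure" using Ns by (simp add: null_sets_def)
  then have "AE \<zeta> in surface_measure. \<zeta> \<notin> N" by (rule AE_not_in)
  moreover have "AE \<zeta> in surface_measure. \<zeta> \<in> space (surface_measure :: (complex ^ 'n) measure)"
    by (rule AE_space)
  ultimately show ?thesis
    by eventually_elim (auto simp: N_def A_def)
qed

subsection \<open>Point evaluations\<close>

text \<open>Cauchy's formula with the kernel bounded by \<open>1 / (1 - norm w)\<close>. The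
  nonnegative integral is used so that the later exchanges of integrals need no
  integrability.\<close>

lemma nn_integral_circle_bound:
  fixes h :: "complex \<Rightarrow> complex"
  assumes h: "h holomorphic_on ball 0 R" and R: "1 < R" and w: "norm w < 1"
  shows "ennreal (norm (h w))
    \<le> ennreal (1 / (1 - norm w)) * (\<integral>\<^sup>+t. ennreal (norm (h (circ t))) * indicator {0..1} t \<partial>lborel)"
proof -
  have sub: "cball 0 1 \<subseteq> ball 0 R" using R by auto
  have c: "continuous_on (cball 0 1) h"
    by (rule continuous_on_subset[OF holomorphic_on_imp_continuous_on[OF h] sub])
  have hol: "h holomorphic_on ball 0 1" by (rule holomorphic_on_subset[OF h]) (use R in auto)
  have cont: "continuous_on {0..1} (\<lambda>t. h (circ t))"
  proof -
    have "continuous_on {0..1} circ" using continuous_on_circ[OF continuous_on_id] by simp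
    moreover have "circ ` {0..1} \<subseteq> cball 0 1" by auto
    ultimately show ?thesis
      using continuous_on_compose continuous_on_subset[OF c] unfolding o_def by blast
  qed
  have int: "((\<lambda>t. norm (h (circ t))) has_integral integral {0..1} (\<lambda>t. norm (h (circ t)))) {0..1}"
    by (intro integrable_integral integrable_continuous_real continuous_on_norm cont)
  have "norm (h w) \<le> 1 / (1 - norm w) * integral {0..1} (\<lambda>t. norm (h (circ t)))"
  proof (rule has_integral_norm_le[OF Cauchy_integral_unit_circle[OF c hol w] has_integral_mult_right[OF int]])
    fix t
    have "1 - norm w \<le> norm (circ t - w)" using norm_triangle_ineq2[of "circ t" w] by simp
    then show "norm (h (circ t) * circ t / (circ t - w)) \<le> 1 / (1 - norm w) * norm (h (circ t))"
      using w by (simp add: norm_divide norm_mult frac_le)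
  qed
  then have "ennreal (norm (h w)) \<le> ennreal (1 / (1 - norm w)) * ennreal (integral {0..1} (\<lambda>t. norm (h (circ t))))"
    using w by (subst ennreal_mult[symmetric])
      (auto intro!: ennreal_leI integral_nonneg integrable_continuous_real continuous_on_norm cont)
  also have "ennreal (integral {0..1} (\<lambda>t. norm (h (circ t)))) = (\<integral>\<^sup>+t. ennreal (norm (h (circ t))) * indicator {0..1} t \<partial>lborel)"
  proof -
    have "(\<integral>\<^sup>+t. ennreal (indicator {0..1} t * norm (h (circ t))) \<partial>lborel) = ennreal (integral {0..1} (\<lambda>t. norm (h (circ t))))"
      by (rule nn_integral_has_integral_lebesgue[OF _ int]) simp
    moreover have "ennreal (indicator {0..1} t * norm (h (circ t))) = ennreal (norm (h (circ t))) * indicator {0..1} t" for t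
      by (simp split: split_indicator)
    ultimately show ?thesis by simp
  qed
  finally show ?thesis .
qed

text \<open>Integrating the mean value inequality over slices: first over small circles around \<open>z\<close>,
  which bounds \<open>f z\<close> by a volume integral, then from the circles inside \<open>ball 0 r\<close> to the circles
  of radius \<open>r\<close>.\<close>

lemma holomorphic_vec_point_bound:
  fixes z :: "complex ^ 'n"
  assumes z: "norm z < 1"
  obtains c \<rho> :: real where "0 < c" "0 < \<rho>" "\<rho> < 1"
    "\<And>f r. holomorphic_vec_on f (ball 0 1) \<Longrightarrow> \<rho> < r \<Longrightarrow> r < 1 \<Longrightarrow>
      ennreal (norm (f z)) \<le> ennreal c * (\<integral>\<^sup>+\<zeta>. ennreal (norm (f (r *\<^sub>R \<zeta>))) \<partial>surface_measure)"
proof -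
  \<comment> \<open>A quarter of the distance to the boundary leaves room twice: the slices
    \<open>z + c *s x\<close> with \<open>norm x < d\<close> stay in the ball for
    \<open>norm c < 2\<close>, and points of norm below \<open>norm z + d\<close> keep the distance
    \<open>d\<close> from every sphere of radius \<open>r > norm z + 2 * d\<close>.\<close>
  define d where "d = (1 - norm z) / 4"
  have d: "0 < d" "norm z + 4 * d = 1" using z by (simp_all add: d_def field_simps)
  define v where "v = measure lborel (ball (0 :: complex ^ 'n) d)"
  have v: "0 < v" unfolding v_def using content_ball_pos[OF d(1)] .
  have vol: "emeasure lborel (ball (0 :: complex ^ 'n) d) = ennreal v"
    unfolding v_def by (rule emeasure_eq_ennreal_measure) (use emeasure_lborel_ball_finite[of "0 :: complex ^ 'n" d] in auto)
  show thesis
  proof (rule that[of "1 / (v * d)" "norm z + 2 * d"])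
    show "0 < 1 / (v * d)" using v d by simp
    show "0 < norm z + 2 * d" "norm z + 2 * d < 1" using d by (smt (verit) norm_ge_zero)+
    fix f :: "complex ^ 'n \<Rightarrow> complex" and r :: real
    note [measurable] = borel_open[OF open_ball] ball_minus_0_borel
    assume f: "holomorphic_vec_on f (ball 0 1)" and r: "norm z + 2 * d < r" "r < 1"
    have r0: "0 < r" using r(1) d by (smt (verit) norm_ge_zero)
    \<comment> \<open>Since \<open>f\<close> is arbitrary off the ball, the cutoff is what makes
      \<open>F\<close> a Borel function on the whole space.\<close>
    define F where "F x = ennreal (indicator (ball 0 1) x *\<^sub>R norm (f x))" for x
    have "(\<lambda>x. indicator (ball 0 1) x *\<^sub>R norm (f x)) \<in> borel_measurable borel"
      by (intro borel_measurable_continuous_on_indicator continuous_on_norm holomorphic_vec_on_imp_continuous_on f) simp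
    then have F[measurable]: "F \<in> borel_measurable borel" unfolding F_def by measurable
    have Fin: "F x = ennreal (norm (f x))" if "norm x < 1" for x using that by (simp add: F_def)
    define G where "G x = F (z + x) * indicator (ball 0 d) x" for x
    have G[measurable]: "G \<in> borel_measurable borel" unfolding G_def by measurable
    \<comment> \<open>The cone integrand for the sphere of radius \<open>r\<close>: up to the
      dimension factor its integral is the surface integral in the claim.\<close>
    define H where "H x = F (r *\<^sub>R (x /\<^sub>R norm x)) * indicator (ball 0 1 - {0}) x" for x
    have H[measurable]: "H \<in> borel_measurable borel" unfolding H_def by measurable
    have near: "F z * indicator (ball 0 d) x \<le> (\<integral>\<^sup>+t. G (circ t *s x) * indicator {0..1} t \<partial>lborel)" for x
    proof (cases "x \<in> ball 0 d")
      case True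
      have inb: "norm (z + c *s x) < 1" if "norm c < 2" for c
      proof -
        have "norm (z + c *s x) \<le> norm z + norm c * norm x"
          using norm_triangle_ineq[of z "c *s x"] by (simp add: norm_vector_smult)
        moreover have "norm c * norm x \<le> 2 * d" using that True by (intro mult_mono) auto
        ultimately show ?thesis using d by linarith
      qed
      have hol: "(\<lambda>c. f (z + c *s x)) holomorphic_on ball 0 2"
        by (rule holomorphic_on_slice[OF f]) (use inb in auto)
      have "F z \<le> (\<integral>\<^sup>+t. ennreal (norm (f (z + circ t *s x))) * indicator {0..1} t \<partial>lborel)"
        using nn_integral_circle_bound[OF hol, of 0] z by (simp add: Fin)
      also have "\<dots> = (\<integral>\<^sup>+t. G (circ t *s x) * indicator {0..1} t \<partial>lborel)"
        using True by (intro nn_integral_cong) (simp add: G_def Fin inb norm_vector_smult)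
      finally show ?thesis using True by simp
    qed simp
    have far: "F x * indicator (ball 0 (norm z + d)) x \<le> ennreal (1 / d) * (\<integral>\<^sup>+t. H (circ t *s x) * indicator {0..1} t \<partial>lborel)"
      if "x \<noteq> 0" for x
    proof (cases "x \<in> ball 0 (norm z + d)")
      case True
      have xr: "norm x + d < r" using True r(1) by simp
      define y where "y = r *\<^sub>R (x /\<^sub>R norm x)"
      have ny: "norm y = r" using that r0 by (simp add: y_def)
      have inb: "norm (c *s y) < 1" if "norm c < 1 / r" for c
        using that r0 by (simp add: norm_vector_smult ny field_simps)
      have hol: "(\<lambda>c. f (0 + c *s y)) holomorphic_on ball 0 (1 / r)"
        by (rule holomorphic_on_slice[OF f]) (use inb in auto)
      have R1: "1 < 1 / r" using r r0 by simp
      \<comment> \<open>The point \<open>x\<close> is seen inside the disc spanned by the vector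
        \<open>y\<close> of norm \<open>r\<close> in its direction. There it has the parameter
        \<open>w\<close>, with \<open>1 - norm w\<close> at least \<open>d\<close>.\<close>
      define w where "w = complex_of_real (norm x / r)"
      have nw: "norm w = norm x / r" using r0 unfolding w_def norm_of_real by simp
      have w1: "norm w < 1" unfolding nw using xr d r0 by simp
      have wy: "w *s y = x"
        unfolding w_def scaleR_vec_eq_smult[symmetric] y_def using that r0 by simp
      have "ennreal (norm (f x)) \<le> ennreal (1 / (1 - norm w)) * (\<integral>\<^sup>+t. ennreal (norm (f (circ t *s y))) * indicator {0..1} t \<partial>lborel)"
        using nn_integral_circle_bound[OF hol R1 w1] by (simp add: wy)
      also have "\<dots> \<le> ennreal (1 / d) * (\<integral>\<^sup>+t. H (circ t *s x) * indicator {0..1} t \<partial>lborel)"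
      proof (rule mult_mono)
        have "1 - norm w = (r - norm x) / r" unfolding nw using r0 by (simp add: field_simps)
        moreover have "d \<le> (r - norm x) / r"
        proof -
          have "d * r \<le> d * 1" using d r by (intro mult_left_mono) auto
          then show ?thesis using r0 xr by (simp add: pos_le_divide_eq)
        qed
        ultimately show "ennreal (1 / (1 - norm w)) \<le> ennreal (1 / d)"
          using d by (intro ennreal_leI frac_le) auto
        have eq: "r *\<^sub>R ((circ t *s x) /\<^sub>R norm (circ t *s x)) = circ t *s y" for t
          unfolding y_def norm_vector_smult by (simp add: vec_eq_iff)
        have "norm (circ t *s y) < 1" for t by (simp add: norm_vector_smult ny r)
        moreover have "circ t *s x \<in> ball 0 1 - {0}" for t
          using that xr r d by (auto simp: norm_vector_smult)
        ultimately have "H (circ t *s x) = ennreal (norm (f (circ t *s y)))" for t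
          unfolding H_def eq by (simp only: Fin indicator_simps mult_1_right)
        then show "(\<integral>\<^sup>+t. ennreal (norm (f (circ t *s y))) * indicator {0..1} t \<partial>lborel)
            \<le> (\<integral>\<^sup>+t. H (circ t *s x) * indicator {0..1} t \<partial>lborel)"
          by simp
      qed auto
      finally show ?thesis using True d by (simp add: Fin)
    qed simp
    have "F z * ennreal v = (\<integral>\<^sup>+x. F z * indicator (ball 0 d) (x :: complex ^ 'n) \<partial>lborel)"
      by (simp add: nn_integral_cmult vol)
    also have "\<dots> \<le> (\<integral>\<^sup>+x. (\<integral>\<^sup>+t. G (circ t *s x) * indicator {0..1} t \<partial>lborel) \<partial>lborel)"
      by (intro nn_integral_mono near)
    also have "\<dots> = (\<integral>\<^sup>+x. G x \<partial>lborel)" by (rule nn_integral_rotation_average[OF G])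
    also have "\<dots> \<le> (\<integral>\<^sup>+x. F (z + x) * indicator (ball 0 (norm z + d)) (z + x) \<partial>lborel)"
    proof (rule nn_integral_mono)
      fix x
      have "norm (z + x) < norm z + d" if "norm x < d" using norm_triangle_ineq[of z x] that by simp
      then show "G x \<le> F (z + x) * indicator (ball 0 (norm z + d)) (z + x)"
        by (simp add: G_def split: split_indicator)
    qed
    also have "\<dots> = (\<integral>\<^sup>+x. F x * indicator (ball 0 (norm z + d)) x \<partial>lborel)"
      by (rule nn_integral_lborel_translate) measurable
    also have "\<dots> \<le> (\<integral>\<^sup>+x. ennreal (1 / d) * (\<integral>\<^sup>+t. H (circ t *s x) * indicator {0..1} t \<partial>lborel) \<partial>lborel)"
      by (rule nn_integral_mono_AE, rule AE_mp[OF AE_lborel_singleton[of 0]]) (auto intro!: AE_I2 far)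
    also have "\<dots> = ennreal (1 / d) * (\<integral>\<^sup>+x. (\<integral>\<^sup>+t. H (circ t *s x) * indicator {0..1} t \<partial>lborel) \<partial>lborel)"
      by (rule nn_integral_cmult, rule lborel.borel_measurable_nn_integral)
        (rule borel_measurable_rotations[OF H])
    also have "(\<integral>\<^sup>+x. (\<integral>\<^sup>+t. H (circ t *s x) * indicator {0..1} t \<partial>lborel) \<partial>lborel) = (\<integral>\<^sup>+x. H x \<partial>lborel)"
      by (rule nn_integral_rotation_average[OF H])
    \<comment> \<open>The dimension factor is at least 1; inserting it completes the surface
      integral.\<close>
    also have "ennreal (1 / d) * (\<integral>\<^sup>+x. H x \<partial>lborel)
        \<le> ennreal (1 / d) * (of_nat DIM(complex ^ 'n) * (\<integral>\<^sup>+x. H x \<partial>lborel))"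
    proof (rule mult_left_mono)
      have "1 \<le> (of_nat DIM(complex ^ 'n) :: ennreal)"
        using DIM_positive[where 'a = "complex ^ 'n"] by (metis Suc_leI One_nat_def of_nat_1 of_nat_mono)
      from mult_right_mono[OF this, of "\<integral>\<^sup>+x. H x \<partial>lborel"]
      show "(\<integral>\<^sup>+x. H x \<partial>lborel) \<le> of_nat DIM(complex ^ 'n) * (\<integral>\<^sup>+x. H x \<partial>lborel)" by simp
    qed simp
    also have "of_nat DIM(complex ^ 'n) * (\<integral>\<^sup>+x. H x \<partial>lborel) = (\<integral>\<^sup>+\<zeta>. F (r *\<^sub>R \<zeta>) \<partial>surface_measure)"
    proof -
      have "(\<lambda>\<zeta>. F (r *\<^sub>R \<zeta>)) \<in> borel_measurable (restrict_space borel (sphere 0 1))"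
        by (intro measurable_restrict_space1) measurable
      then have "(\<lambda>\<zeta>. F (r *\<^sub>R \<zeta>)) \<in> borel_measurable surface_measure"
        by (simp add: measurable_cong_sets[OF sets_surface_measure refl])
      from nn_integral_surface_measure[OF this] show ?thesis unfolding H_def by simp
    qed
    also have "\<dots> = (\<integral>\<^sup>+\<zeta>. ennreal (norm (f (r *\<^sub>R \<zeta>))) \<partial>surface_measure)"
      by (rule nn_integral_cong) (use r r0 in \<open>simp add: Fin\<close>)
    finally have "F z * ennreal v * ennreal (1 / v)
        \<le> ennreal (1 / d) * (\<integral>\<^sup>+\<zeta>. ennreal (norm (f (r *\<^sub>R \<zeta>))) \<partial>surface_measure) * ennreal (1 / v)"
      by (rule mult_right_mono) simp
    moreover have "F z * ennreal v * ennreal (1 / v) = ennreal (norm (f z))"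
      using v z by (simp add: Fin mult.assoc ennreal_mult[symmetric])
    moreover have "ennreal (1 / d) * J * ennreal (1 / v) = ennreal (1 / (v * d)) * J" for J
    proof -
      have "ennreal (1 / d) * J * ennreal (1 / v) = (ennreal (1 / v) * ennreal (1 / d)) * J"
        by (simp only: mult_ac)
      also have "ennreal (1 / v) * ennreal (1 / d) = ennreal (1 / v * (1 / d))"
        using v d by (intro ennreal_mult[symmetric]) auto
      finally show ?thesis by simp
    qed
    ultimately show "ennreal (norm (f z)) \<le> ennreal (1 / (v * d)) * (\<integral>\<^sup>+\<zeta>. ennreal (norm (f (r *\<^sub>R \<zeta>))) \<partial>surface_measure)"
      by simp
  qed
qed

subsection \<open>Nonisotropic balls\<close>

lemma Re_hdot: "Re (hdot \<eta> \<zeta>) = \<eta> \<bullet> \<zeta>"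
  by (simp add: hdot_def inner_vec_def inner_complex_def)

lemma Im_hdot: "Im (hdot \<eta> \<zeta>) = \<eta> \<bullet> (\<i> *s \<zeta>)"
  by (simp add: hdot_def inner_vec_def inner_complex_def algebra_simps)

lemma continuous_on_hdot: "continuous_on S (\<lambda>\<eta>. hdot \<eta> \<zeta>)"
  unfolding hdot_def by (intro continuous_intros)

lemma sets_nonisotropic_ball: "nonisotropic_ball \<zeta> \<epsilon> \<in> sets surface_measure"
proof (rule sets_surface_measureI)
  have "open {\<eta>. cmod (1 - hdot \<eta> \<zeta>) < \<epsilon>}"
    by (intro open_Collect_less continuous_intros continuous_on_hdot)
  then have "sphere 0 1 \<inter> {\<eta>. cmod (1 - hdot \<eta> \<zeta>) < \<epsilon>} \<in> sets borel"
    by (intro sets.Int borel_open[of "Collect _"] borel_closed[of "sphere _ _"]) auto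
  then show "nonisotropic_ball \<zeta> \<epsilon> \<in> sets borel"
    by (simp add: nonisotropic_ball_def Int_def)
qed (auto simp: nonisotropic_ball_def)

text \<open>Bounding each of the coordinate products by 1 gives a radius at which the Morrey mean
  becomes an integral over the whole sphere.\<close>

lemma nonisotropic_ball_eq_sphere:
  fixes \<zeta> :: "complex ^ 'n"
  assumes "norm \<zeta> = 1"
  shows "nonisotropic_ball \<zeta> (real CARD('n) + 2) = sphere 0 1"
proof -
  have "cmod (1 - hdot \<eta> \<zeta>) < real CARD('n) + 2" if "norm \<eta> = 1" for \<eta>
  proof -
    have "cmod (hdot \<eta> \<zeta>) \<le> (\<Sum>j\<in>(UNIV :: 'n set). 1)"
      unfolding hdot_def
    proof (rule sum_norm_le)
      fix j
      have "norm (\<eta> $ j) * norm (\<zeta> $ j) \<le> 1 * 1"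
        using Finite_Cartesian_Product.norm_nth_le[where x = \<eta>, of j] that assms
          Finite_Cartesian_Product.norm_nth_le[where x = \<zeta>, of j] by (intro mult_mono) auto
      then show "cmod (\<eta> $ j * cnj (\<zeta> $ j)) \<le> 1" by (simp add: norm_mult)
    qed
    then show ?thesis using norm_triangle_ineq4[of 1 "hdot \<eta> \<zeta>"] by simp
  qed
  then show ?thesis by (auto simp: nonisotropic_ball_def)
qed

lemma inner_sq_sum_le:
  fixes x a b :: "'a::real_inner"
  assumes "norm a = 1" "norm b = 1" "a \<bullet> b = 0"
  shows "(x \<bullet> a)\<^sup>2 + (x \<bullet> b)\<^sup>2 \<le> (norm x)\<^sup>2"
proof -
  define y where "y = x - (x \<bullet> a) *\<^sub>R a - (x \<bullet> b) *\<^sub>R b"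
  have aa: "a \<bullet> a = 1" "b \<bullet> b = 1" using assms by (simp_all add: norm_eq_1)
  have "0 \<le> y \<bullet> y" by simp
  also have "y \<bullet> y = x \<bullet> x - (x \<bullet> a)\<^sup>2 - (x \<bullet> b)\<^sup>2"
    using aa assms(3)
    by (simp add: y_def inner_simps inner_commute[of a x] inner_commute[of b x] inner_commute[of b a] power2_eq_square)
  finally show ?thesis by (simp add: power2_norm_eq_inner)
qed

text \<open>After an isometry taking \<open>\<zeta>\<close> and \<open>\<i> *s \<zeta>\<close> to coordinate vectors, the cone over the
  nonisotropic ball lies in a box with side lengths of order \<open>1\<close>, \<open>\<epsilon>\<close> and \<open>2 * CARD('n) - 2\<close> times
  \<open>sqrt \<epsilon>\<close>.\<close>

lemma emeasure_nonisotropic_ball_le: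
  fixes \<zeta> :: "complex ^ 'n"
  assumes \<zeta>: "norm \<zeta> = 1" and \<epsilon>: "0 < \<epsilon>" "\<epsilon> \<le> 1"
  shows "emeasure surface_measure (nonisotropic_ball \<zeta> \<epsilon>)
    \<le> ennreal (real DIM(complex ^ 'n) * 8 ^ DIM(complex ^ 'n) * \<epsilon> ^ CARD('n))"
proof -
  define k :: 'n where "k = undefined"
  define e1 e2 :: "complex ^ 'n" where "e1 = axis k 1" and "e2 = axis k \<i>"
  have eB: "e1 \<in> Basis" "e2 \<in> Basis"
    unfolding e1_def e2_def Basis_vec_def by (auto simp: Basis_complex_def)
  have e12: "e1 \<noteq> e2" by (simp add: e1_def e2_def axis_eq_axis)
  have en: "norm e1 = 1" "norm e2 = 1" "e1 \<bullet> e2 = 0"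
    using eB e12 by (simp_all add: inner_not_same_Basis)
  have orth: "\<zeta> \<bullet> (\<i> *s \<zeta>) = 0" "norm (\<i> *s \<zeta>) = 1"
    unfolding Im_hdot[symmetric] using \<zeta> by (simp_all add: hdot_def norm_vector_smult)
  obtain T where T: "linear T" "\<And>x. norm (T x) = norm x" "T \<zeta> = e1" "T (\<i> *s \<zeta>) = e2"
    by (rule isometry_orthonormal_pair[OF \<zeta> orth(2,1) en]) blast
  have inner: "T x \<bullet> T y = x \<bullet> y" for x y
    using T(2)[of "x + y"] T(2)[of x] T(2)[of y]
    by (simp add: linear_add[OF T(1)] norm_eq inner_simps inner_commute)
  \<comment> \<open>Half side lengths of the box. The component along \<open>e1\<close> is at least
    \<open>1 - \<epsilon>\<close>, which leaves at most
    \<open>1 - (1 - \<epsilon>)\<^sup>2 \<le> 2 * \<epsilon>\<close> for the square of any component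
    orthogonal to it; along \<open>e2\<close> the imaginary part gives the better bound
    \<open>\<epsilon>\<close>.\<close>
  define w where "w b = (if b = e1 then 1 else if b = e2 then \<epsilon> else sqrt (2 * \<epsilon>))" for b
  have w0: "0 \<le> w b" for b using \<epsilon> by (simp add: w_def)
  define W where "W = (\<Sum>b\<in>Basis. w b *\<^sub>R b)"
  have Wb: "W \<bullet> b = w b" if "b \<in> Basis" for b unfolding W_def using that by simp
  have key: "T x \<in> cbox (- W) W" if x: "x \<in> ball 0 1 - {0}" "x /\<^sub>R norm x \<in> nonisotropic_ball \<zeta> \<epsilon>" for x
  proof -
    define u where "u = x /\<^sub>R norm x"
    have x1: "0 < norm x" "norm x < 1" using x by auto
    have xu: "x = norm x *\<^sub>R u" and nu: "norm u = 1" using x1 by (simp_all add: u_def)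
    have h: "cmod (1 - hdot u \<zeta>) < \<epsilon>" using x(2) by (simp add: nonisotropic_ball_def u_def)
    have re: "1 - \<epsilon> \<le> u \<bullet> \<zeta>"
      using abs_Re_le_cmod[of "1 - hdot u \<zeta>"] h by (simp add: Re_hdot)
    have im: "\<bar>u \<bullet> (\<i> *s \<zeta>)\<bar> \<le> \<epsilon>"
      using abs_Im_le_cmod[of "1 - hdot u \<zeta>"] h by (simp add: Im_hdot)
    have Tb: "\<bar>T u \<bullet> b\<bar> \<le> w b" if "b \<in> Basis" for b
    proof -
      consider "b = e1" | "b = e2" "b \<noteq> e1" | "b \<noteq> e1" "b \<noteq> e2" by blast
      then show ?thesis
      proof cases
        case 1
        then show ?thesis
          using Cauchy_Schwarz_ineq2[of "T u" e1] T(2)[of u] nu en by (simp add: w_def)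
      next
        case 2
        then show ?thesis using im inner[of u "\<i> *s \<zeta>"] T(4) by (simp add: w_def)
      next
        case 3
        have "(T u \<bullet> e1)\<^sup>2 + (T u \<bullet> b)\<^sup>2 \<le> 1"
          using inner_sq_sum_le[of e1 b "T u"] en that 3 eB T(2)[of u] nu
          by (simp add: inner_not_same_Basis)
        moreover have "(1 - \<epsilon>)\<^sup>2 \<le> (T u \<bullet> e1)\<^sup>2"
          using re inner[of u \<zeta>] T(3) \<epsilon> by (intro power_mono) auto
        moreover have "1 - (1 - \<epsilon>)\<^sup>2 \<le> 2 * \<epsilon>" by (simp add: power2_eq_square algebra_simps)
        ultimately have "(T u \<bullet> b)\<^sup>2 \<le> 2 * \<epsilon>" by linarith
        then show ?thesis using 3 real_sqrt_le_mono by (fastforce simp: w_def)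
      qed
    qed
    have "\<bar>T x \<bullet> b\<bar> \<le> w b" if "b \<in> Basis" for b
    proof -
      have "T x \<bullet> b = norm x * (T u \<bullet> b)"
        by (subst xu) (simp add: linear_scale[OF T(1)])
      then have "\<bar>T x \<bullet> b\<bar> = norm x * \<bar>T u \<bullet> b\<bar>" by (simp add: abs_mult)
      also have "\<dots> \<le> 1 * w b" using x1 Tb[OF that] by (intro mult_mono) auto
      finally show ?thesis by simp
    qed
    then have "- w b \<le> T x \<bullet> b \<and> T x \<bullet> b \<le> w b" if "b \<in> Basis" for b
      using that by (simp add: abs_le_iff) (metis minus_le_iff)
    then show ?thesis unfolding mem_box by (simp add: Wb)
  qed
  have Tm: "T \<in> borel_measurable borel"
    using T(1) by (intro borel_measurable_continuous_onI linear_continuous_on linear_conv_bounded_linear[THEN iffD1])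
  have "emeasure surface_measure (nonisotropic_ball \<zeta> \<epsilon>)
      = of_nat DIM(complex ^ 'n) * (\<integral>\<^sup>+x. indicator (nonisotropic_ball \<zeta> \<epsilon>) (x /\<^sub>R norm x) * indicator (ball 0 1 - {0}) x \<partial>lborel)"
    by (rule emeasure_surface_measure[OF sets_nonisotropic_ball])
  also have "\<dots> \<le> of_nat DIM(complex ^ 'n) * (\<integral>\<^sup>+x. indicator (cbox (- W) W) (T x) \<partial>lborel)"
    by (intro mult_left_mono nn_integral_mono) (use key in \<open>auto split: split_indicator\<close>)
  also have "(\<integral>\<^sup>+x. indicator (cbox (- W) W) (T x) \<partial>lborel) = emeasure lborel (cbox (- W) W)"
    by (subst nn_integral_lborel_isometry[OF T(1,2)]) simp_all
  also have "\<dots> = ennreal (\<Prod>b\<in>Basis. 2 * w b)"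
  proof -
    have "emeasure lborel (cbox (- W) W) = ennreal (\<Prod>b\<in>Basis. (W - (- W)) \<bullet> b)"
      by (rule emeasure_lborel_cbox) (simp add: Wb w0)
    also have "(\<Prod>b\<in>Basis. (W - (- W)) \<bullet> b) = (\<Prod>b\<in>Basis. 2 * w b)"
      by (rule prod.cong[OF refl]) (simp only: inner_diff_left inner_minus_left Wb)
    finally show ?thesis .
  qed
  also have "of_nat DIM(complex ^ 'n) * ennreal (\<Prod>b\<in>Basis. 2 * w b) = ennreal (real DIM(complex ^ 'n) * (\<Prod>b\<in>Basis. 2 * w b))"
    by (simp add: ennreal_mult ennreal_of_nat_eq_real_of_nat prod_nonneg w0)
  also have "\<dots> \<le> ennreal (real DIM(complex ^ 'n) * (8 ^ DIM(complex ^ 'n) * \<epsilon> ^ CARD('n)))"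
  proof (intro ennreal_leI mult_left_mono)
    let ?B = "Basis :: (complex ^ 'n) set"
    obtain m where m: "CARD('n) = Suc m"
      using zero_less_card_finite[where 'a = 'n] gr0_conv_Suc by blast
    have cB: "card ?B = 2 * CARD('n)" by simp
    \<comment> \<open>The two special directions contribute \<open>4 * \<epsilon>\<close>, and each
      pair of the remaining \<open>2 * m\<close> directions contributes
      \<open>8 * \<epsilon>\<close>, which yields the power \<open>Suc m\<close>.\<close>
    have "(\<Prod>b\<in>?B. 2 * w b) = 2 * w e1 * (2 * w e2 * (\<Prod>b\<in>?B - {e1} - {e2}. 2 * w b))"
      using eB e12 by (simp add: prod.remove[of ?B e1] prod.remove[of "?B - {e1}" e2])
    also have "(\<Prod>b\<in>?B - {e1} - {e2}. 2 * w b) = (\<Prod>b\<in>?B - {e1} - {e2}. 2 * sqrt (2 * \<epsilon>))"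
      by (rule prod.cong) (auto simp: w_def)
    also have "\<dots> = (2 * sqrt (2 * \<epsilon>)) ^ (2 * m)"
    proof -
      have "card (?B - {e1} - {e2}) = 2 * m"
        using eB e12 cB by (simp add: card_Diff_singleton m)
      then show ?thesis by (simp only: prod_constant)
    qed
    also have "\<dots> = (8 * \<epsilon>) ^ m"
      using \<epsilon> by (simp add: power_mult power_mult_distrib)
    also have "2 * w e1 * (2 * w e2 * (8 * \<epsilon>) ^ m) = 4 * 8 ^ m * \<epsilon> ^ Suc m"
      using e12 by (simp add: w_def power_mult_distrib)
    also have "\<dots> \<le> 8 ^ Suc m * \<epsilon> ^ Suc m"
      using \<epsilon> by (intro mult_right_mono) auto
    also have "\<dots> \<le> 8 ^ DIM(complex ^ 'n) * \<epsilon> ^ CARD('n)"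
      unfolding m using \<epsilon> by (intro mult_right_mono power_increasing) (auto simp: m)
    finally show "(\<Prod>b\<in>?B. 2 * w b) \<le> 8 ^ DIM(complex ^ 'n) * \<epsilon> ^ CARD('n)" .
  qed simp
  finally show ?thesis by (simp add: mult.assoc)
qed

subsection \<open>Morrey and Hardy-Morrey spaces\<close>

lemma integrable_surface_measure_continuous:
  fixes f :: "'a::euclidean_space \<Rightarrow> real"
  assumes "continuous_on (sphere 0 1) f"
  shows "integrable surface_measure f"
proof -
  have "bounded (f ` sphere 0 1)"
    by (intro compact_imp_bounded compact_continuous_image assms) simp
  then obtain B where B: "\<And>x. x \<in> sphere 0 1 \<Longrightarrow> norm (f x) \<le> B"
    unfolding bounded_iff by blast
  show ?thesis
    by (rule surface_measure.integrable_const_bound[where B = B])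
      (use B in \<open>auto intro!: AE_I2 borel_measurable_surface_measure_continuous assms\<close>)
qed

lemma continuous_on_dilate:
  fixes f :: "'a::real_normed_vector \<Rightarrow> 'b::topological_space"
  assumes f: "continuous_on (ball 0 1) f" and r: "0 < r" "r < 1"
  shows "continuous_on (sphere 0 1) (\<lambda>x. f (r *\<^sub>R x))"
proof (rule continuous_on_compose2[OF f])
  show "(\<lambda>x. r *\<^sub>R x) ` sphere 0 1 \<subseteq> ball (0::'a) 1"
    using r by (simp add: image_subset_iff)
qed (intro continuous_intros)

lemma continuous_on_norm_powr:
  fixes f :: "'a::topological_space \<Rightarrow> 'b::real_normed_vector"
  assumes "continuous_on S f" "0 < p"
  shows "continuous_on S (\<lambda>x. norm (f x) powr p)"
  using assms by (intro continuous_on_powr' continuous_intros) auto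

lemma morrey_mean_nonneg: "0 \<le> morrey_mean p s f \<zeta> \<epsilon>"
  by (simp add: morrey_mean_def)

lemma sphere_nonempty_vec: "sphere (0 :: complex ^ 'n) 1 \<noteq> {}"
  by simp

text \<open>The bound is required only almost everywhere, because the boundary values of a product
  are identified only off a null set.\<close>

lemma Lp_sphere_dominated:
  fixes f h :: "complex ^ 'n \<Rightarrow> complex"
  assumes f: "f \<in> Lp_sphere p" and h: "h \<in> borel_measurable surface_measure"
    and le: "AE \<eta> in surface_measure. cmod (h \<eta>) \<le> M * cmod (f \<eta>)" and M: "0 \<le> M" and p: "0 < p"
  shows "h \<in> Lp_sphere p" and "0 < \<epsilon> \<Longrightarrow> morrey_mean p s h \<zeta> \<epsilon> \<le> M * morrey_mean p s f \<zeta> \<epsilon>"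
proof -
  have intf: "integrable surface_measure (\<lambda>\<eta>. cmod (f \<eta>) powr p)"
    using f by (simp add: Lp_sphere_def)
  have le': "AE \<eta> in surface_measure. cmod (h \<eta>) powr p \<le> M powr p * cmod (f \<eta>) powr p"
    using le
  proof eventually_elim
    case (elim \<eta>)
    then have "cmod (h \<eta>) powr p \<le> (M * cmod (f \<eta>)) powr p" using p by (intro powr_mono2) auto
    then show ?case using M by (simp add: powr_mult)
  qed
  have inth: "integrable surface_measure (\<lambda>\<eta>. cmod (h \<eta>) powr p)"
  proof (rule Bochner_Integration.integrable_bound)
    show "integrable surface_measure (\<lambda>\<eta>. M powr p * cmod (f \<eta>) powr p)" using intf by simp
    show "(\<lambda>\<eta>. cmod (h \<eta>) powr p) \<in> borel_measurable surface_measure" using h by measurable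
    show "AE \<eta> in surface_measure. norm (cmod (h \<eta>) powr p) \<le> norm (M powr p * cmod (f \<eta>) powr p)"
      using le' by eventually_elim simp
  qed
  then show "h \<in> Lp_sphere p" using h by (simp add: Lp_sphere_def)
  assume \<epsilon>: "0 < \<epsilon>"
  let ?I = "nonisotropic_ball \<zeta> \<epsilon>"
  have si: "set_integrable surface_measure ?I (\<lambda>\<eta>. cmod (f \<eta>) powr p)"
      "set_integrable surface_measure ?I (\<lambda>\<eta>. cmod (h \<eta>) powr p)"
    unfolding set_integrable_def
    by (intro integrable_mult_indicator sets_nonisotropic_ball intf inth)+
  have "(LINT \<eta>:?I|surface_measure. cmod (h \<eta>) powr p)
      \<le> (LINT \<eta>:?I|surface_measure. M powr p * cmod (f \<eta>) powr p)"
    unfolding set_lebesgue_integral_def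
  proof (rule integral_mono_AE)
    show "integrable surface_measure (\<lambda>\<eta>. indicat_real ?I \<eta> *\<^sub>R cmod (h \<eta>) powr p)"
      using si(2) by (simp add: set_integrable_def)
    show "integrable surface_measure (\<lambda>\<eta>. indicat_real ?I \<eta> *\<^sub>R (M powr p * cmod (f \<eta>) powr p))"
      using integrable_mult_right[OF si(1)[unfolded set_integrable_def], of "M powr p"] by (simp add: mult_ac)
    show "AE \<eta> in surface_measure. indicat_real ?I \<eta> *\<^sub>R cmod (h \<eta>) powr p
        \<le> indicat_real ?I \<eta> *\<^sub>R (M powr p * cmod (f \<eta>) powr p)"
      using le' by eventually_elim (simp add: mult_left_mono)
  qed
  also have "\<dots> = M powr p * (LINT \<eta>:?I|surface_measure. cmod (f \<eta>) powr p)" by simp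
  finally have le: "(LINT \<eta>:?I|surface_measure. cmod (h \<eta>) powr p)
      \<le> M powr p * (LINT \<eta>:?I|surface_measure. cmod (f \<eta>) powr p)" .
  from mult_left_mono[OF le powr_ge_zero[of \<epsilon> "s * p - real CARD('n)"]]
  have "\<epsilon> powr (s * p - real CARD('n)) * (LINT \<eta>:?I|surface_measure. cmod (h \<eta>) powr p)
      \<le> M powr p * (\<epsilon> powr (s * p - real CARD('n)) * (LINT \<eta>:?I|surface_measure. cmod (f \<eta>) powr p))"
    by (simp only: mult.left_commute[of _ "M powr p"])
  then have "morrey_mean p s h \<zeta> \<epsilon> \<le> (M powr p * (\<epsilon> powr (s * p - real CARD('n)) *
      (LINT \<eta>:?I|surface_measure. cmod (f \<eta>) powr p))) powr (1 / p)"
    unfolding morrey_mean_def using p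
    by (intro powr_mono2) (auto simp: set_lebesgue_integral_def)
  also have "\<dots> = M * morrey_mean p s f \<zeta> \<epsilon>"
  proof -
    have "(M powr p) powr (1 / p) = M" using M p by (simp add: powr_powr)
    moreover have "0 \<le> (LINT \<eta>:?I|surface_measure. cmod (f \<eta>) powr p)"
      by (simp add: set_lebesgue_integral_def)
    ultimately show ?thesis unfolding morrey_mean_def by (subst powr_mult) auto
  qed
  finally show "morrey_mean p s h \<zeta> \<epsilon> \<le> M * morrey_mean p s f \<zeta> \<epsilon>" .
qed

lemma morrey_mean_le_norm:
  assumes "f \<in> morrey p s" "\<zeta> \<in> sphere 0 1" "0 < \<epsilon>"
  shows "morrey_mean p s f \<zeta> \<epsilon> \<le> morrey_norm p s f"
proof -
  have "bdd_above ((\<lambda>(\<zeta>, \<epsilon>). morrey_mean p s f \<zeta> \<epsilon>) ` (sphere 0 1 \<times> {0<..}))"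
    using assms by (simp add: morrey_def)
  from cSUP_upper[OF _ this, of "(\<zeta>, \<epsilon>)"] assms show ?thesis
    by (simp add: morrey_norm_def)
qed

lemma morrey_norm_nonneg:
  fixes f :: "complex ^ 'n \<Rightarrow> complex"
  assumes "f \<in> morrey p s"
  shows "0 \<le> morrey_norm p s f"
proof -
  obtain \<zeta> :: "complex ^ 'n" where "\<zeta> \<in> sphere 0 1" using sphere_nonempty_vec by blast
  from morrey_mean_le_norm[OF assms this, of 1] morrey_mean_nonneg[of p s f \<zeta> 1] show ?thesis by simp
qed

lemma morrey_dominated:
  fixes f h :: "complex ^ 'n \<Rightarrow> complex"
  assumes f: "f \<in> morrey p s" and h: "h \<in> borel_measurable surface_measure"
    and le: "AE \<eta> in surface_measure. cmod (h \<eta>) \<le> M * cmod (f \<eta>)" and M: "0 \<le> M" and p: "0 < p"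
  shows "h \<in> morrey p s" and "morrey_norm p s h \<le> M * morrey_norm p s f"
proof -
  have fL: "f \<in> Lp_sphere p" using f by (simp add: morrey_def)
  have le: "morrey_mean p s h \<zeta> \<epsilon> \<le> M * morrey_norm p s f" if "\<zeta> \<in> sphere 0 1" "0 < \<epsilon>" for \<zeta> \<epsilon>
    using Lp_sphere_dominated(2)[OF fL h le M p that(2)] mult_left_mono[OF morrey_mean_le_norm[OF f that] M]
    by (rule order_trans)
  have "bdd_above ((\<lambda>(\<zeta>, \<epsilon>). morrey_mean p s h \<zeta> \<epsilon>) ` (sphere 0 1 \<times> {0<..}))"
    by (rule bdd_aboveI2[where M = "M * morrey_norm p s f"]) (use le in auto)
  then show "h \<in> morrey p s"
    using Lp_sphere_dominated(1)[OF fL h assms(3) M p] by (simp add: morrey_def)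
  show "morrey_norm p s h \<le> M * morrey_norm p s f"
    unfolding morrey_norm_def[of p s h]
    by (rule cSUP_least) (use le in \<open>auto simp: ex_in_conv[symmetric]\<close>)
qed

text \<open>The supremum is tested at the single radius for which the nonisotropic ball is the whole
  sphere.\<close>

lemma Lp_norm_le_morrey_norm:
  fixes f :: "complex ^ 'n \<Rightarrow> complex"
  assumes f: "f \<in> morrey p s" and p: "0 < p"
  shows "(LINT \<eta>|surface_measure. cmod (f \<eta>) powr p)
    \<le> (real CARD('n) + 2) powr (real CARD('n) - s * p) * morrey_norm p s f powr p"
proof -
  obtain \<zeta> :: "complex ^ 'n" where \<zeta>: "\<zeta> \<in> sphere 0 1" using sphere_nonempty_vec by blast
  define E where "E = real CARD('n) + 2"
  have E: "0 < E" by (simp add: E_def)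
  define J where "J = (LINT \<eta>|surface_measure. cmod (f \<eta>) powr p)"
  have J: "0 \<le> J" by (simp add: J_def)
  have "(LINT \<eta>:nonisotropic_ball \<zeta> E|surface_measure. cmod (f \<eta>) powr p) = J"
    unfolding J_def set_lebesgue_integral_def E_def
    by (rule Bochner_Integration.integral_cong) (use \<zeta> nonisotropic_ball_eq_sphere[of \<zeta>] in auto)
  then have "(E powr (s * p - real CARD('n)) * J) powr (1 / p) \<le> morrey_norm p s f"
    using morrey_mean_le_norm[OF f \<zeta> E] by (simp add: morrey_mean_def)
  then have "((E powr (s * p - real CARD('n)) * J) powr (1 / p)) powr p \<le> morrey_norm p s f powr p"
    using p by (intro powr_mono2) auto
  then have "E powr (s * p - real CARD('n)) * J \<le> morrey_norm p s f powr p"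
    using p J by (simp add: powr_powr)
  then have le: "E powr (real CARD('n) - s * p) * (E powr (s * p - real CARD('n)) * J)
      \<le> E powr (real CARD('n) - s * p) * morrey_norm p s f powr p"
    by (intro mult_left_mono) auto
  have "E powr (real CARD('n) - s * p) * E powr (s * p - real CARD('n)) = 1"
    using E by (simp add: powr_add[symmetric])
  then have eq: "E powr (real CARD('n) - s * p) * (E powr (s * p - real CARD('n)) * J) = J"
    by (simp only: mult.assoc[symmetric] mult_1_left)
  show ?thesis using le unfolding eq unfolding J_def E_def .
qed

lemma boundary_value_eq:
  "((\<lambda>r. f (r *\<^sub>R \<zeta>)) \<longlongrightarrow> L) (at_left 1) \<Longrightarrow> boundary_value f \<zeta> = L"
  unfolding boundary_value_def by (rule tendsto_Lim[OF trivial_limit_at_left_real])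

text \<open>There are two regimes. For small \<open>\<epsilon>\<close> the size of the nonisotropic
  balls leaves \<open>\<epsilon> powr (s * p)\<close>, bounded because \<open>s\<close> is positive;
  for large \<open>\<epsilon>\<close> the total measure is finite and the exponent
  \<open>s * p - n\<close> is at most 0.\<close>

lemma one_in_morrey:
  assumes p: "0 < p" and s: "0 < s" "s * p \<le> real CARD('n)"
  shows "(\<lambda>_ :: complex ^ 'n. 1) \<in> morrey p s"
proof -
  let ?\<sigma> = "surface_measure :: (complex ^ 'n) measure"
  let ?n = "real CARD('n)"
  define C where "C = max (real DIM(complex ^ 'n) * 8 ^ DIM(complex ^ 'n)) (measure ?\<sigma> (sphere 0 1))"
  have C0: "0 \<le> C" by (simp add: C_def le_max_iff_disj)
  have le: "morrey_mean p s (\<lambda>_. 1) \<zeta> \<epsilon> \<le> C powr (1 / p)"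
    if \<zeta>: "\<zeta> \<in> sphere 0 1" and \<epsilon>: "0 < \<epsilon>" for \<zeta> :: "complex ^ 'n" and \<epsilon>
  proof -
    let ?I = "nonisotropic_ball \<zeta> \<epsilon>"
    have int: "(LINT \<eta>:?I|?\<sigma>. cmod 1 powr p) = measure ?\<sigma> ?I"
    proof -
      have "?I \<inter> space ?\<sigma> = ?I" by (auto simp: nonisotropic_ball_def)
      then show ?thesis by (simp add: set_lebesgue_integral_def del: space_surface_measure)
    qed
    have "\<epsilon> powr (s * p - ?n) * measure ?\<sigma> ?I \<le> C"
    proof (cases "\<epsilon> \<le> 1")
      case True
      have "measure ?\<sigma> ?I \<le> real DIM(complex ^ 'n) * 8 ^ DIM(complex ^ 'n) * \<epsilon> ^ CARD('n)"
        using emeasure_nonisotropic_ball_le[of \<zeta> \<epsilon>] \<zeta> \<epsilon> True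
        by (simp add: measure_def enn2real_leI)
      also have "\<dots> \<le> C * \<epsilon> ^ CARD('n)" using \<epsilon> by (intro mult_right_mono) (auto simp: C_def)
      finally have "\<epsilon> powr (s * p - ?n) * measure ?\<sigma> ?I \<le> \<epsilon> powr (s * p - ?n) * (C * \<epsilon> powr ?n)"
        using \<epsilon> by (intro mult_left_mono) (auto simp: powr_realpow)
      also have "\<dots> = C * \<epsilon> powr (s * p)"
        using \<epsilon> by (simp add: powr_diff)
      also have "\<dots> \<le> C * 1"
        using \<epsilon> True s p C0 by (intro mult_left_mono powr_le1) auto
      finally show ?thesis by simp
    next
      case False
      have "\<epsilon> powr (s * p - ?n) \<le> \<epsilon> powr 0" using False s by (intro powr_mono) auto
      moreover have "measure ?\<sigma> ?I \<le> measure ?\<sigma> (sphere 0 1)"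
        by (rule surface_measure.finite_measure_mono)
          (auto simp: nonisotropic_ball_def intro!: sets.top[of ?\<sigma>, simplified])
      ultimately have "\<epsilon> powr (s * p - ?n) * measure ?\<sigma> ?I \<le> 1 * measure ?\<sigma> (sphere 0 1)"
        using \<epsilon> by (intro mult_mono) auto
      then show ?thesis by (simp add: C_def)
    qed
    then show ?thesis
      unfolding morrey_mean_def int using p by (intro powr_mono2) auto
  qed
  have "bdd_above ((\<lambda>(\<zeta>, \<epsilon>). morrey_mean p s (\<lambda>_ :: complex ^ 'n. 1) \<zeta> \<epsilon>) ` (sphere 0 1 \<times> {0<..}))"
    by (rule bdd_aboveI2[where M = "C powr (1 / p)"]) (use le in auto)
  then show ?thesis by (simp add: morrey_def Lp_sphere_def)
qed

lemma one_in_hardy_morrey: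
  assumes p: "0 < p" and s: "0 < s" "s * p \<le> real CARD('n)"
  shows "(\<lambda>_ :: complex ^ 'n. 1) \<in> hardy_morrey p s"
proof -
  have bv: "boundary_value (\<lambda>_ :: complex ^ 'n. 1) = (\<lambda>_. 1)"
    by (rule ext, rule boundary_value_eq) simp
  have "holomorphic_vec_on (\<lambda>_ :: complex ^ 'n. 1) (ball 0 1)"
    unfolding holomorphic_vec_on_def by (auto intro!: exI[of _ "\<lambda>_. 0"])
  then show ?thesis
    using one_in_morrey[OF assms] by (simp add: hardy_morrey_def hardy_def bv image_constant_conv)
qed

lemma hardy_morreyD:
  assumes "f \<in> hardy_morrey p s"
  shows "holomorphic_vec_on f (ball 0 1)" "boundary_value f \<in> morrey p s"
    "bdd_above ((\<lambda>r. LINT \<zeta>|surface_measure. cmod (f (r *\<^sub>R \<zeta>)) powr p) ` {0<..<1})"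
    "AE \<zeta> in surface_measure. ((\<lambda>r. f (r *\<^sub>R \<zeta>)) \<longlongrightarrow> boundary_value f \<zeta>) (at_left 1)"
  using assms by (auto simp: hardy_morrey_def hardy_def)

section \<open>Multiplication by bounded holomorphic functions\<close>

lemma holomorphic_vec_on_mult:
  assumes "holomorphic_vec_on f U" "holomorphic_vec_on g U"
  shows "holomorphic_vec_on (\<lambda>z. f z * g z) U"
  unfolding holomorphic_vec_on_def
proof
  fix z assume "z \<in> U"
  then obtain D E where D: "(f has_derivative D) (at z)" "\<And>c v. D (c *s v) = c * D v"
    and E: "(g has_derivative E) (at z)" "\<And>c v. E (c *s v) = c * E v"
    using assms unfolding holomorphic_vec_on_def by meson
  show "\<exists>D. ((\<lambda>z. f z * g z) has_derivative D) (at z) \<and> (\<forall>c v. D (c *s v) = c * D v)"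
    using has_derivative_mult[OF D(1) E(1)] D(2) E(2)
    by (intro exI conjI) (auto simp: algebra_simps)
qed

text \<open>Where both radial limits exist, the boundary value of the product is that of
  \<open>f\<close> times a limit \<open>L\<close> of values of \<open>g\<close>, so its modulus is
  at most \<open>M\<close> times that of \<open>f\<close>.\<close>

lemma bounded_holomorphic_mult_hardy_morrey:
  fixes f g :: "complex ^ 'n \<Rightarrow> complex"
  assumes g: "holomorphic_vec_on g (ball 0 1)" and M: "\<And>z. z \<in> ball 0 1 \<Longrightarrow> cmod (g z) \<le> M"
    and f: "f \<in> hardy_morrey p s" and p: "0 < p"
  shows "(\<lambda>z. g z * f z) \<in> hardy_morrey p s"
    and "hardy_morrey_norm p s (\<lambda>z. g z * f z) \<le> M * hardy_morrey_norm p s f"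
proof -
  note fD = hardy_morreyD[OF f]
  have M0: "0 \<le> M" using M[of 0] norm_ge_zero[of "g 0"] by (simp del: norm_ge_zero)
  have hol: "holomorphic_vec_on (\<lambda>z. g z * f z) (ball 0 1)"
    by (rule holomorphic_vec_on_mult[OF g fD(1)])
  have cont: "continuous_on (ball 0 1) g" "continuous_on (ball 0 1) f" "continuous_on (ball 0 1) (\<lambda>z. g z * f z)"
    using g fD(1) hol by (auto intro: holomorphic_vec_on_imp_continuous_on)
  have "\<exists>A. \<forall>r\<in>{0<..<1}. (LINT \<zeta>|surface_measure. cmod (f (r *\<^sub>R \<zeta>)) powr p) \<le> A"
    using fD(3) unfolding bdd_above_def by auto
  then obtain A where "\<forall>r\<in>{0<..<1}. (LINT \<zeta>|surface_measure. cmod (f (r *\<^sub>R \<zeta>)) powr p) \<le> A" ..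
  then have A: "(LINT \<zeta>|surface_measure. cmod (f (r *\<^sub>R \<zeta>)) powr p) \<le> A" if "0 < r" "r < 1" for r
    using that by simp
  have "(LINT \<zeta>|surface_measure. cmod (g (r *\<^sub>R \<zeta>) * f (r *\<^sub>R \<zeta>)) powr p) \<le> M powr p * A"
    if r: "0 < r" "r < 1" for r
  proof -
    have "(LINT \<zeta>|surface_measure. cmod (g (r *\<^sub>R \<zeta>) * f (r *\<^sub>R \<zeta>)) powr p)
        \<le> (LINT \<zeta>|surface_measure. M powr p * cmod (f (r *\<^sub>R \<zeta>)) powr p)"
    proof (rule integral_mono)
      show "integrable surface_measure (\<lambda>\<zeta>. cmod (g (r *\<^sub>R \<zeta>) * f (r *\<^sub>R \<zeta>)) powr p)"
        by (intro integrable_surface_measure_continuous continuous_on_norm_powr p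
            continuous_on_dilate[OF cont(3) r])
      show "integrable surface_measure (\<lambda>\<zeta>. M powr p * cmod (f (r *\<^sub>R \<zeta>)) powr p)"
        by (intro integrable_mult_right integrable_surface_measure_continuous continuous_on_norm_powr p
            continuous_on_dilate[OF cont(2) r])
      fix \<zeta> :: "complex ^ 'n" assume "\<zeta> \<in> space surface_measure"
      then have "cmod (g (r *\<^sub>R \<zeta>)) \<le> M" using r by (intro M) simp
      then have "cmod (g (r *\<^sub>R \<zeta>) * f (r *\<^sub>R \<zeta>)) powr p \<le> (M * cmod (f (r *\<^sub>R \<zeta>))) powr p"
        using p by (intro powr_mono2) (auto simp: norm_mult intro: mult_right_mono)
      then show "cmod (g (r *\<^sub>R \<zeta>) * f (r *\<^sub>R \<zeta>)) powr p \<le> M powr p * cmod (f (r *\<^sub>R \<zeta>)) powr p"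
        using M0 by (simp add: powr_mult)
    qed
    also have "\<dots> \<le> M powr p * A" using A[OF r] by (simp add: mult_left_mono)
    finally show ?thesis .
  qed
  then have hardy: "(\<lambda>z. g z * f z) \<in> hardy p"
    unfolding hardy_def using hol by (auto intro!: bdd_aboveI2)
  have "bounded (g ` ball 0 1)" unfolding bounded_iff using M by blast
  note Fatou = AE_radial_limit_bounded_holomorphic[OF g this]
  have AE: "AE \<zeta> in surface_measure.
      ((\<lambda>r. g (r *\<^sub>R \<zeta>) * f (r *\<^sub>R \<zeta>)) \<longlongrightarrow> boundary_value (\<lambda>z. g z * f z) \<zeta>) (at_left 1) \<and>
      cmod (boundary_value (\<lambda>z. g z * f z) \<zeta>) \<le> M * cmod (boundary_value f \<zeta>)"
    using Fatou fD(4) AE_space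
  proof eventually_elim
    case (elim \<zeta>)
    then obtain L where L: "((\<lambda>r. g (r *\<^sub>R \<zeta>)) \<longlongrightarrow> L) (at_left 1)" by blast
    have lim: "((\<lambda>r. g (r *\<^sub>R \<zeta>) * f (r *\<^sub>R \<zeta>)) \<longlongrightarrow> L * boundary_value f \<zeta>) (at_left 1)"
      by (intro tendsto_mult L elim)
    have bv: "boundary_value (\<lambda>z. g z * f z) \<zeta> = L * boundary_value f \<zeta>"
      by (rule boundary_value_eq[OF lim])
    have "cmod L \<le> M"
    proof (rule tendsto_upperbound[OF tendsto_norm[OF L]])
      have "cmod (g (r *\<^sub>R \<zeta>)) \<le> M" if "0 < r" "r < 1" for r
        using that elim by (intro M) simp
      then show "\<forall>\<^sub>F r in at_left 1. cmod (g (r *\<^sub>R \<zeta>)) \<le> M"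
        unfolding eventually_at_left_field by (intro exI[of _ 0]) auto
    qed simp
    then show ?case unfolding bv using lim by (auto simp: norm_mult intro: mult_right_mono)
  qed
  have meas: "boundary_value (\<lambda>z. g z * f z) \<in> borel_measurable surface_measure"
    by (rule borel_measurable_boundary_value[OF cont(3)])
  have le: "AE \<zeta> in surface_measure. cmod (boundary_value (\<lambda>z. g z * f z) \<zeta>) \<le> M * cmod (boundary_value f \<zeta>)"
    using AE by eventually_elim simp
  have lim: "AE \<zeta> in surface_measure. ((\<lambda>r. g (r *\<^sub>R \<zeta>) * f (r *\<^sub>R \<zeta>)) \<longlongrightarrow> boundary_value (\<lambda>z. g z * f z) \<zeta>) (at_left 1)"
    using AE by eventually_elim simp
  show "(\<lambda>z. g z * f z) \<in> hardy_morrey p s"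
    unfolding hardy_morrey_def using hardy lim morrey_dominated(1)[OF fD(2) meas le M0 p] by simp
  show "hardy_morrey_norm p s (\<lambda>z. g z * f z) \<le> M * hardy_morrey_norm p s f"
    unfolding hardy_morrey_norm_def by (rule morrey_dominated(2)[OF fD(2) meas le M0 p])
qed

text \<open>Above the level \<open>L\<close> one has \<open>x = x powr (1 - p) * x powr p\<close>,
  and the first factor is at most \<open>L powr (1 - p)\<close> because \<open>1 - p\<close> is
  negative. The truncated form is for passing to the boundary; the other one takes the place of
  Hoelder's inequality, with the level left free.\<close>

lemma le_add_powr:
  fixes x L p :: real
  assumes "0 \<le> x" "0 < L" "1 < p"
  shows "x \<le> min x L + L powr (1 - p) * x powr p" and "x \<le> L + L powr (1 - p) * x powr p"
proof -
  have nn: "0 \<le> L powr (1 - p) * x powr p" by simp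
  have big: "x \<le> L powr (1 - p) * x powr p" if "L < x"
  proof -
    have "x powr (1 - p) \<le> L powr (1 - p)" using assms that by (intro powr_mono2') auto
    then have "x powr (1 - p) * x powr p \<le> L powr (1 - p) * x powr p" by (rule mult_right_mono) simp
    then show ?thesis using assms that by (simp add: powr_add[symmetric])
  qed
  show "x \<le> min x L + L powr (1 - p) * x powr p"
    using nn big assms(2) min.absorb1[of x L] min.absorb2[of L x] by (cases "L < x") linarith+
  show "x \<le> L + L powr (1 - p) * x powr p"
    using nn big assms(2) by (cases "L < x") linarith+
qed

text \<open>The bound \<open>A\<close> of the Hardy norm enters only through the uniform integrability of the dilates
  of \<open>f\<close> and disappears as the truncation level \<open>L\<close> tends to infinity.\<close>

lemma point_bound_boundary_value:
  fixes z :: "complex ^ 'n"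
  assumes z: "norm z < 1" and p: "1 < p"
  obtains c where "0 < c" "\<And>f \<mu> s. f \<in> hardy_morrey p s \<Longrightarrow> 0 < \<mu> \<Longrightarrow>
    cmod (f z) \<le> c * (\<mu> * measure surface_measure (sphere (0 :: complex ^ 'n) 1) +
      \<mu> powr (1 - p) * (LINT \<zeta>|surface_measure. cmod (boundary_value f \<zeta>) powr p))"
proof -
  obtain c \<rho> :: real where c: "0 < c" "0 < \<rho>" "\<rho> < 1" and bound:
    "\<And>f r. holomorphic_vec_on f (ball 0 1) \<Longrightarrow> \<rho> < r \<Longrightarrow> r < 1 \<Longrightarrow>
      ennreal (norm (f z)) \<le> ennreal c * (\<integral>\<^sup>+\<zeta>. ennreal (norm (f (r *\<^sub>R \<zeta>))) \<partial>surface_measure)"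
    by (rule holomorphic_vec_point_bound[OF z]) blast
  show thesis
  proof (rule that[OF c(1)])
    fix f :: "complex ^ 'n \<Rightarrow> complex" and \<mu> s :: real
    assume f: "f \<in> hardy_morrey p s" and \<mu>: "0 < \<mu>"
    note fD = hardy_morreyD[OF f]
    have cont: "continuous_on (ball 0 1) f" by (rule holomorphic_vec_on_imp_continuous_on[OF fD(1)])
    have "\<exists>A. \<forall>r\<in>{0<..<1}. (LINT \<zeta>|surface_measure. cmod (f (r *\<^sub>R \<zeta>)) powr p) \<le> A"
      using fD(3) unfolding bdd_above_def by auto
    then obtain A where "\<forall>r\<in>{0<..<1}. (LINT \<zeta>|surface_measure. cmod (f (r *\<^sub>R \<zeta>)) powr p) \<le> A" ..
    then have A: "(LINT \<zeta>|surface_measure. cmod (f (r *\<^sub>R \<zeta>)) powr p) \<le> A" if "0 < r" "r < 1" for r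
      using that by simp
    have bvL: "boundary_value f \<in> borel_measurable surface_measure"
      "integrable surface_measure (\<lambda>\<zeta>. cmod (boundary_value f \<zeta>) powr p)"
      using fD(2) by (auto simp: morrey_def Lp_sphere_def)
    define B where "B = (LINT \<zeta>|surface_measure. cmod (boundary_value f \<zeta>) powr p)"
    define S where "S = measure surface_measure (sphere (0 :: complex ^ 'n) 1)"
    have trunc: "cmod (f z) \<le> c * ((\<mu> * S + \<mu> powr (1 - p) * B) + L powr (1 - p) * A)" if L: "0 < L" for L
    proof -
      \<comment> \<open>Radii increasing to 1 that all lie beyond \<open>\<rho>\<close>, where the
        estimate by spherical means holds.\<close>
      define u where "u i = 1 - (1 - \<rho>) / (real i + 2)" for i :: nat
      have u: "\<rho> < u i" "u i < 1" for i
      proof -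
        have "(1 - \<rho>) / (real i + 2) < 1 - \<rho>" using c by (simp add: divide_less_eq)
        then show "\<rho> < u i" by (simp add: u_def)
        show "u i < 1" using c by (simp add: u_def)
      qed
      have u0: "0 < u i" for i using u(1)[of i] c by simp
      have "u \<longlonglongrightarrow> 1" unfolding u_def by real_asymp
      then have ulim: "filterlim u (at_left 1) sequentially"
        using u(2) less_imp_neq[OF u(2)] by (auto simp: filterlim_at intro!: always_eventually)
      have contr: "continuous_on (sphere 0 1) (\<lambda>\<zeta>. f (u i *\<^sub>R \<zeta>))" for i
        by (rule continuous_on_dilate[OF cont u0 u(2)])
      have i1: "integrable surface_measure (\<lambda>\<zeta>. cmod (f (u i *\<^sub>R \<zeta>)))" for i
        by (intro integrable_surface_measure_continuous continuous_on_norm contr)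
      have i2: "integrable surface_measure (\<lambda>\<zeta>. min (cmod (f (u i *\<^sub>R \<zeta>))) L)" for i
        by (intro integrable_surface_measure_continuous continuous_on_min continuous_on_norm continuous_on_const contr)
      have i3: "integrable surface_measure (\<lambda>\<zeta>. cmod (f (u i *\<^sub>R \<zeta>)) powr p)" for i
        using p by (intro integrable_surface_measure_continuous continuous_on_norm_powr contr) auto
      have step: "cmod (f z) \<le> c * ((LINT \<zeta>|surface_measure. min (cmod (f (u i *\<^sub>R \<zeta>))) L) + L powr (1 - p) * A)" for i
      proof -
        have "ennreal (cmod (f z)) \<le> ennreal c * (\<integral>\<^sup>+\<zeta>. ennreal (norm (f (u i *\<^sub>R \<zeta>))) \<partial>surface_measure)"
          by (rule bound[OF fD(1) u])
        also have "\<dots> = ennreal (c * (LINT \<zeta>|surface_measure. cmod (f (u i *\<^sub>R \<zeta>))))"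
          using c by (subst nn_integral_eq_integral[OF i1]) (auto simp: ennreal_mult)
        finally have "cmod (f z) \<le> c * (LINT \<zeta>|surface_measure. cmod (f (u i *\<^sub>R \<zeta>)))"
          using c by (subst (asm) ennreal_le_iff) auto
        also have "(LINT \<zeta>|surface_measure. cmod (f (u i *\<^sub>R \<zeta>)))
            \<le> (LINT \<zeta>|surface_measure. min (cmod (f (u i *\<^sub>R \<zeta>))) L + L powr (1 - p) * cmod (f (u i *\<^sub>R \<zeta>)) powr p)"
          using L p by (intro integral_mono i1 Bochner_Integration.integrable_add i2 integrable_mult_right i3 le_add_powr(1)) auto
        also have "\<dots> = (LINT \<zeta>|surface_measure. min (cmod (f (u i *\<^sub>R \<zeta>))) L)
            + L powr (1 - p) * (LINT \<zeta>|surface_measure. cmod (f (u i *\<^sub>R \<zeta>)) powr p)"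
          using i2 i3 by simp
        also have "\<dots> \<le> (LINT \<zeta>|surface_measure. min (cmod (f (u i *\<^sub>R \<zeta>))) L) + L powr (1 - p) * A"
          using A[OF u0 u(2)] by (intro add_left_mono mult_left_mono) auto
        finally show ?thesis using c by (simp add: mult_left_mono)
      qed
      \<comment> \<open>Truncation supplies the constant majorant \<open>L\<close>, integrable
        because the surface measure is finite; the untruncated dilates come with no common
        majorant.\<close>
      have "(\<lambda>i. LINT \<zeta>|surface_measure. min (cmod (f (u i *\<^sub>R \<zeta>))) L)
          \<longlonglongrightarrow> (LINT \<zeta>|surface_measure. min (cmod (boundary_value f \<zeta>)) L)"
      proof (rule integral_dominated_convergence[where w = "\<lambda>_. L"])
        show "AE \<zeta> in surface_measure. (\<lambda>i. min (cmod (f (u i *\<^sub>R \<zeta>))) L) \<longlonglongrightarrow> min (cmod (boundary_value f \<zeta>)) L"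
          using fD(4)
        proof eventually_elim
          case (elim \<zeta>)
          show ?case by (intro tendsto_intros filterlim_compose[OF elim ulim])
        qed
        show "integrable surface_measure (\<lambda>_ :: complex ^ 'n. L)" by simp
        show "(\<lambda>\<zeta>. min (cmod (boundary_value f \<zeta>)) L) \<in> borel_measurable surface_measure"
          using bvL(1) by measurable
        show "(\<lambda>\<zeta>. min (cmod (f (u i *\<^sub>R \<zeta>))) L) \<in> borel_measurable surface_measure" for i
          using i2 by blast
      qed (use L in auto)
      from tendsto_mult_left[OF tendsto_add[OF this tendsto_const], of c "L powr (1 - p) * A"]
      have "cmod (f z) \<le> c * ((LINT \<zeta>|surface_measure. min (cmod (boundary_value f \<zeta>)) L) + L powr (1 - p) * A)"
        by (rule LIMSEQ_le_const) (use step in blast)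
      also have "(LINT \<zeta>|surface_measure. min (cmod (boundary_value f \<zeta>)) L)
          \<le> (LINT \<zeta>|surface_measure. \<mu> + \<mu> powr (1 - p) * cmod (boundary_value f \<zeta>) powr p)"
      proof (rule integral_mono)
        show "integrable surface_measure (\<lambda>\<zeta>. min (cmod (boundary_value f \<zeta>)) L)"
          using bvL(1) L by (intro surface_measure.integrable_const_bound[where B = L]) auto
        show "integrable surface_measure (\<lambda>\<zeta>. \<mu> + \<mu> powr (1 - p) * cmod (boundary_value f \<zeta>) powr p)"
          using bvL(2) by simp
        show "min (cmod (boundary_value f \<zeta>)) L \<le> \<mu> + \<mu> powr (1 - p) * cmod (boundary_value f \<zeta>) powr p" for \<zeta>
          using le_add_powr(2)[OF norm_ge_zero \<mu> p, of "boundary_value f \<zeta>"] by linarith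
      qed
      also have "\<dots> = \<mu> * S + \<mu> powr (1 - p) * B"
        using bvL(2) by (simp add: B_def S_def)
      finally show ?thesis using c by (simp add: mult_left_mono)
    qed
    have "((\<lambda>L. c * ((\<mu> * S + \<mu> powr (1 - p) * B) + L powr (1 - p) * A)) \<longlongrightarrow>
        c * ((\<mu> * S + \<mu> powr (1 - p) * B) + 0 * A)) at_top"
      using p by (intro tendsto_intros tendsto_neg_powr filterlim_ident) auto
    then have "cmod (f z) \<le> c * ((\<mu> * S + \<mu> powr (1 - p) * B) + 0 * A)"
      by (rule tendsto_lowerbound) (auto intro!: eventually_mono[OF eventually_gt_at_top[of 0]] trunc)
    then show "cmod (f z) \<le> c * (\<mu> * measure surface_measure (sphere (0 :: complex ^ 'n) 1) +
        \<mu> powr (1 - p) * (LINT \<zeta>|surface_measure. cmod (boundary_value f \<zeta>) powr p))"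
      by (simp add: S_def B_def)
  qed
qed

theorem proposition3p6:
  fixes p s :: real and g :: "complex ^ 'n \<Rightarrow> complex"
  assumes "CARD('n) > 1"
    and "1 < p"
    and "0 < s" and "s \<le> real CARD('n) / p"
  shows "pointwise_multiplier (hardy_morrey p s) (hardy_morrey_norm p s) g \<longleftrightarrow>
         g \<in> hardy_infinity"
proof
  assume "g \<in> hardy_infinity"
  then have g: "holomorphic_vec_on g (ball 0 1)" and bd: "bounded (g ` ball 0 1)"
    by (auto simp: hardy_infinity_def)
  obtain M where M: "\<And>z. z \<in> ball 0 1 \<Longrightarrow> cmod (g z) \<le> M"
    using bd unfolding bounded_iff by blast
  have "0 < p" using assms by simp
  note mult = bounded_holomorphic_mult_hardy_morrey[OF g M _ this]
  show "pointwise_multiplier (hardy_morrey p s) (hardy_morrey_norm p s) g"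
    unfolding pointwise_multiplier_def using mult by blast
next
  let ?X = "hardy_morrey p s :: (complex ^ 'n \<Rightarrow> complex) set" and ?N = "hardy_morrey_norm p s :: (complex ^ 'n \<Rightarrow> complex) \<Rightarrow> real"
  assume mult: "pointwise_multiplier ?X ?N g"
  have p: "1 < p" "0 < p" "0 \<le> p" using assms by auto
  have sp: "s * p \<le> real CARD('n)" using assms p by (simp add: field_simps)
  have X: "(\<lambda>z. g z * f z) \<in> ?X" if "f \<in> ?X" for f
    using mult that by (simp add: pointwise_multiplier_def)
  obtain C0 where C0: "\<And>f. f \<in> ?X \<Longrightarrow> ?N (\<lambda>z. g z * f z) \<le> C0 * ?N f"
    using mult by (auto simp: pointwise_multiplier_def)
  \<comment> \<open>The bound in the definition of a multiplier may be any real number; enlarging it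
    makes all powers of \<open>C\<close> positive and allows division by them.\<close>
  define C where "C = max C0 1"
  have C: "1 \<le> C" by (simp add: C_def)
  have N0: "0 \<le> ?N f" if "f \<in> ?X" for f
    unfolding hardy_morrey_norm_def by (rule morrey_norm_nonneg[OF hardy_morreyD(2)[OF that]])
  have one: "(\<lambda>_. 1) \<in> ?X" by (rule one_in_hardy_morrey[OF p(2) assms(3) sp])
  define N1 where "N1 = ?N (\<lambda>_. 1)"
  have N1: "0 \<le> N1" unfolding N1_def by (rule N0[OF one])
  have pow: "(\<lambda>z. g z ^ k) \<in> ?X \<and> ?N (\<lambda>z. g z ^ k) \<le> C ^ k * N1" for k
  proof (induction k)
    case 0
    then show ?case using one by (simp add: N1_def)
  next
    case (Suc k)
    then have k: "(\<lambda>z. g z ^ k) \<in> ?X" and le: "?N (\<lambda>z. g z ^ k) \<le> C ^ k * N1" by auto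
    have "?N (\<lambda>z. g z * g z ^ k) \<le> C0 * ?N (\<lambda>z. g z ^ k)" by (rule C0[OF k])
    also have "\<dots> \<le> C * ?N (\<lambda>z. g z ^ k)" by (intro mult_right_mono N0 k) (simp add: C_def)
    also have "\<dots> \<le> C * (C ^ k * N1)" using C by (intro mult_left_mono le) auto
    finally show ?case using X[OF k] by (simp add: mult.assoc)
  qed
  have bound: "cmod (g z) \<le> C" if z: "norm z < 1" for z
  proof (rule ccontr)
    assume "\<not> cmod (g z) \<le> C"
    then have gt: "1 < cmod (g z) / C" using C by simp
    define S where "S = measure surface_measure (sphere (0 :: complex ^ 'n) 1)"
    define K where "K = (real CARD('n) + 2) powr (real CARD('n) - s * p)"
    obtain c where c: "0 < c" "\<And>f \<mu> s. f \<in> hardy_morrey p s \<Longrightarrow> 0 < \<mu> \<Longrightarrow>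
        cmod (f z) \<le> c * (\<mu> * S + \<mu> powr (1 - p) * (LINT \<zeta>|surface_measure. cmod (boundary_value f \<zeta>) powr p))"
      unfolding S_def by (rule point_bound_boundary_value[OF z p(1)]) blast
    \<comment> \<open>The free level in the point estimate is set to \<open>C ^ k\<close>, the
      growth rate of the norm of \<open>g ^ k\<close>. Both terms then scale like
      \<open>C ^ k\<close>, and dividing by it leaves a bound independent of
      \<open>k\<close>.\<close>
    have "(cmod (g z) / C) ^ k \<le> c * (S + K * N1 powr p)" for k
    proof -
      let ?f = "\<lambda>z. g z ^ k"
      have Ck: "0 < C ^ k" using C by simp
      have "(LINT \<zeta>|surface_measure. cmod (boundary_value ?f \<zeta>) powr p) \<le> K * ?N ?f powr p"
        unfolding K_def hardy_morrey_norm_def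
        by (rule Lp_norm_le_morrey_norm[OF hardy_morreyD(2)[OF conjunct1[OF pow]] p(2)])
      also have "\<dots> \<le> K * (C ^ k * N1) powr p"
        using pow[of k] N0[of ?f] p by (intro mult_left_mono powr_mono2) (auto simp: K_def)
      also have "(C ^ k * N1) powr p = (C ^ k) powr p * N1 powr p"
        using Ck N1 by (simp add: powr_mult)
      finally have "(LINT \<zeta>|surface_measure. cmod (boundary_value ?f \<zeta>) powr p) \<le> K * ((C ^ k) powr p * N1 powr p)" .
      then have "(C ^ k) powr (1 - p) * (LINT \<zeta>|surface_measure. cmod (boundary_value ?f \<zeta>) powr p)
          \<le> (C ^ k) powr (1 - p) * (K * ((C ^ k) powr p * N1 powr p))"
        by (intro mult_left_mono) auto
      also have "\<dots> = ((C ^ k) powr (1 - p) * (C ^ k) powr p) * (K * N1 powr p)" by (simp only: mult_ac)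
      also have "(C ^ k) powr (1 - p) * (C ^ k) powr p = C ^ k"
        using Ck by (simp add: powr_add[symmetric])
      finally have "C ^ k * S + (C ^ k) powr (1 - p) * (LINT \<zeta>|surface_measure. cmod (boundary_value ?f \<zeta>) powr p)
          \<le> C ^ k * (S + K * N1 powr p)" by (simp add: distrib_left)
      then have "c * (C ^ k * S + (C ^ k) powr (1 - p) * (LINT \<zeta>|surface_measure. cmod (boundary_value ?f \<zeta>) powr p))
          \<le> c * (C ^ k * (S + K * N1 powr p))"
        using c(1) by (intro mult_left_mono) auto
      with c(2)[OF conjunct1[OF pow] Ck, of k] have "cmod (g z) ^ k \<le> c * (C ^ k * (S + K * N1 powr p))"
        by (simp add: norm_power)
      then show ?thesis using Ck by (simp add: power_divide divide_le_eq mult_ac)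
    qed
    moreover obtain k where "c * (S + K * N1 powr p) < (cmod (g z) / C) ^ k"
      using real_arch_pow[OF gt] by blast
    ultimately show False by (meson not_le)
  qed
  have "holomorphic_vec_on g (ball 0 1)"
    using X[OF one] hardy_morreyD(1) by fastforce
  moreover have "bounded (g ` ball 0 1)"
    unfolding bounded_iff using bound by (intro exI[of _ C]) auto
  ultimately show "g \<in> hardy_infinity" by (simp add: hardy_infinity_def)
qed

end
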